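(* Fix $0<\alpha<1$ and let $\{\mathcal{A}^{(n)}\}_{n\ge1}$ and $\{\mathcal{B}^{(n)}\}_{n\ge1}$ be two sequences of infinite matrices (bounded operators on $\ell^2(\mathbb{N})$), each satisfying Hypothesis H($\alpha$). Then for every $\beta>\alpha$ and every integer $m\ge2$ there is a constant $C(m,\beta)$, independent of $n$, such that as $n\to\infty$ $$\left|\mathcal{C}^{(n)}_m(\mathcal{B}^{(n)})-\mathcal{C}^{(n)}_m(\mathcal{A}^{(n)})\right|\le C(m,\beta)\left\|P_{\{n-2mn^\beta,\,n+2mn^\beta\}}\left(\mathcal{B}^{(n)}-\mathcal{A}^{(n)}\right)P_{\{n-2mn^\beta,\,n+2mn^\beta\}}\right\|_1+o(1).$$
   Context: Hypothesis H($\alpha$): a sequence $\{\mathcal{A}^{(n)}\}$ of infinite matrices satisfies H($\alpha$) if (1) $\sup_n\|\mathcal{A}^{(n)}\|_\infty<\infty$ (operator norm on $\ell^2(\mathbb{N})$) and (2) there are constants $C,C'>0$ independent of $n$ with $|\mathcal{A}^{(n)}_{r,s}|\le Ce^{-C'|r-s|/n^\alpha}$ for all $r,s$. $P_n$ denotes the orthogonal projection on $\ell^2(\mathbb{N})$ onto the first $n$ coordinates ($P_k=0$ for $k\le0$); for $0<\ell_1<\ell_2$, $P_{\{\ell_1,\ell_2\}}=P_{[\ell_2]+1}-P_{[\ell_1]-1}$ with $[x]$ the integer part. For a bounded matrix $\mathcal{A}$ and $m\ge2$, $$\mathcal{C}^{(n)}_m(\mathcal{A})=\sum_{j=1}^m\frac{(-1)^{j+1}}{j}\sum_{\substack{l_1+\cdots+l_j=m\\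 l_i\ge1}}\frac{\operatorname{Tr}\mathcal{A}^{l_1}P_n\cdots\mathcal{A}^{l_j}P_n-\operatorname{Tr}\mathcal{A}^mP_n}{l_1!\cdots l_j!}.$$ $\|\cdot\|_1$ is the trace norm. *)

theory Defs
  imports "HOL-Analysis.Analysis" "Jordan_Normal_Form.Schur_Decomposition"
begin

text \<open>Infinite matrices indexed by nat (0-based: coordinate i+1 of the paper is index i).\<close>
type_synonym imat = "nat \<Rightarrow> nat \<Rightarrow> complex"

definition ell2 :: "(nat \<Rightarrow> complex) \<Rightarrow> bool" where
  "ell2 x \<longleftrightarrow> (\<lambda>i. (cmod (x i))^2) summable_on UNIV"

definition mat_vec :: "imat \<Rightarrow> (nat \<Rightarrow> complex) \<Rightarrow> (nat \<Rightarrow> complex)" where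
  "mat_vec A x = (\<lambda>r. \<Sum>\<^sub>\<infinity>s. A r s * x s)"

definition op_norm_le :: "imat \<Rightarrow> real \<Rightarrow> bool" where
  "op_norm_le A K \<longleftrightarrow> (\<forall>x. ell2 x \<longrightarrow>
      (\<forall>r. (\<lambda>s. A r s * x s) summable_on UNIV) \<and> ell2 (mat_vec A x) \<and>
      (\<Sum>\<^sub>\<infinity>r. (cmod (mat_vec A x r))^2) \<le> K^2 * (\<Sum>\<^sub>\<infinity>i. (cmod (x i))^2))"

definition hypH :: "real \<Rightarrow> (nat \<Rightarrow> imat) \<Rightarrow> bool" where
  "hypH \<alpha> A \<longleftrightarrow>
     (\<exists>K. \<forall>n\<ge>1. op_norm_le (A n) K) \<and>
     (\<exists>C C'. C > 0 \<and> C' > 0 \<and>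
        (\<forall>n\<ge>1. \<forall>r s. cmod (A n r s) \<le> C * exp (- C' * \<bar>real r - real s\<bar> / real n powr \<alpha>)))"

definition mmult :: "imat \<Rightarrow> imat \<Rightarrow> imat" where
  "mmult A B = (\<lambda>r s. \<Sum>\<^sub>\<infinity>k. A r k * B k s)"

definition ident :: imat where
  "ident = (\<lambda>r s. if r = s then 1 else 0)"

fun mpow :: "imat \<Rightarrow> nat \<Rightarrow> imat" where
  "mpow A 0 = ident"
| "mpow A (Suc l) = mmult A (mpow A l)"

definition Pk :: "int \<Rightarrow> imat" where
  "Pk k = (\<lambda>r s. if r = s \<and> int r < k then 1 else 0)"

definition Pint :: "real \<Rightarrow> real \<Rightarrow> imat" where
  "Pint l1 l2 = (\<lambda>r s. Pk (\<lfloor>l2\<rfloor> + 1) r s - Pk (\<lfloor>l1\<rfloor> - 1) r s)"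

definition mtrace :: "imat \<Rightarrow> complex" where
  "mtrace X = (\<Sum>\<^sub>\<infinity>i. X i i)"

text \<open>Trace norm of a finite complex square matrix: sum of its singular values, i.e. of the
  square roots of the eigenvalues of M^* M counted with algebraic multiplicity.\<close>
definition trace_norm_mat :: "complex mat \<Rightarrow> real" where
  "trace_norm_mat M =
     (let p = char_poly (mat_adjoint M * M) in
      \<Sum>z\<in>{z. poly p z = 0}. real (Polynomial.order z p) * sqrt (Re z))"

text \<open>Trace norm of the finite-rank matrix P_{l1,l2} X P_{l1,l2}; all its nonzero entries
  lie in the leading N x N block with N = [l2]+1.\<close>
definition trace_norm_compr :: "real \<Rightarrow> real \<Rightarrow> imat \<Rightarrow> real" where
  "trace_norm_compr l1 l2 X =
     (let N = nat (\<lfloor>l2\<rfloor> + 1); Y = mmult (Pint l1 l2) (mmult X (Pint l1 l2)) in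
      trace_norm_mat (mat N N (\<lambda>(i,j). Y i j)))"

definition prodP :: "nat \<Rightarrow> imat \<Rightarrow> nat list \<Rightarrow> imat" where
  "prodP n A ls = foldr (\<lambda>l M. mmult (mmult (mpow A l) (Pk (int n))) M) ls ident"

definition compositions :: "nat \<Rightarrow> nat \<Rightarrow> nat list set" where
  "compositions m j = {ls. length ls = j \<and> (\<forall>l\<in>set ls. l \<ge> 1) \<and> sum_list ls = m}"

definition Cm :: "nat \<Rightarrow> nat \<Rightarrow> imat \<Rightarrow> complex" where
  "Cm n m A = (\<Sum>j=1..m. ((-1) ^ (j+1) / of_nat j) *
      (\<Sum>ls\<in>compositions m j.
         (mtrace (prodP n A ls) - mtrace (mmult (mpow A m) (Pk (int n))))
           / of_nat (\<Prod>l\<leftarrow>ls. fact l)))"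

end

theory Submission
  imports Defs "HOL-Real_Asymp.Real_Asymp"
begin

text \<open>
  Each trace difference in \<open>\<C>\<^sub>m\<close> is a sum over closed paths that start below \<open>n\<close> and visit a
  point that is at least \<open>n\<close>. Such a path can leave the window of half-width \<open>2mn\<^sup>\<beta>\<close> around \<open>n\<close> only
  if its total variation is at least \<open>2mn\<^sup>\<beta>\<close>. Half of the exponential decay on the scale \<open>n\<^sup>\<alpha>\<close> then
  gives a factor \<open>exp (- c n\<^bsup>\<beta> - \<alpha>\<^esup>)\<close>, and the other half makes the sum over all paths polynomially
  bounded, so both matrices may be replaced by their compressions to the window up to \<open>o(1)\<close>. For
  the compressions one exchanges the factors of the products one at a time and uses
  \<open>\<bar>tr (Z D)\<bar> \<le> \<parallel>Z\<parallel> \<parallel>D\<parallel>\<^sub>1\<close>.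
\<close>

section \<open>Duality between the operator norm and the trace norm\<close>

unbundle no vec_syntax

text \<open>The two halves of the argument tolerate different losses. With decay rate
  \<open>c / n powr \<alpha>\<close> the entrywise bound allows row sums of order
  \<open>n powr \<alpha>\<close>. Such polynomial factors are harmless in the localization error,
  but they would spoil a constant independent of \<open>n\<close>; the exchange of factors therefore
  rests on the uniform operator bound, which compressions inherit. A second obstacle is that
  associativity and cyclicity are delicate for infinite matrices whose products are unordered sums.
  Paths of fixed length give absolutely summable families from which the first step can be split
  off, and after compression only \<open>N\<close> by \<open>N\<close> matrices remain. There the
  trace norm is given through the roots of a characteristic polynomial, so the duality bound is
  reached by a unitary triangularisation whose diagonal lists exactly those roots.\<close>

lemma mat_adjoint_dim [simp]:
  "dim_row (mat_adjoint A) = dim_col A" "dim_col (mat_adjoint A) = dim_row A"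
  by (simp_all add: mat_adjoint_def)

lemma mat_adjoint_carrier [simp]:
  "A \<in> carrier_mat n m \<Longrightarrow> mat_adjoint A \<in> carrier_mat m n"
  by (intro carrier_matI) auto

lemma mat_adjoint_index [simp]:
  fixes A :: "complex mat"
  assumes "i < dim_col A" "j < dim_row A"
  shows "mat_adjoint A $$ (i, j) = cnj (A $$ (j, i))"
  using assms by (simp add: mat_adjoint_def mat_of_rows_def conjugate_complex_def)

lemma mult_mat_index_sum:
  assumes "A \<in> carrier_mat n p" "B \<in> carrier_mat p q" "i < n" "j < q"
  shows "(A * B) $$ (i, j) = (\<Sum>k<p. A $$ (i, k) * B $$ (k, j))"
  using assms by (auto simp: scalar_prod_def lessThan_atLeast0 intro!: sum.cong)

lemma mat_adjoint_mult:
  fixes A B :: "complex mat"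
  assumes A: "A \<in> carrier_mat n p" and B: "B \<in> carrier_mat p q"
  shows "mat_adjoint (A * B) = mat_adjoint B * mat_adjoint A"
proof (rule eq_matI)
  fix i j assume "i < dim_row (mat_adjoint B * mat_adjoint A)"
    and "j < dim_col (mat_adjoint B * mat_adjoint A)"
  then have ij: "i < q" "j < n" using A B by auto
  have "mat_adjoint (A * B) $$ (i, j) = cnj ((A * B) $$ (j, i))"
    using A B ij by (subst mat_adjoint_index) auto
  also have "\<dots> = (\<Sum>k<p. mat_adjoint B $$ (i, k) * mat_adjoint A $$ (k, j))"
    using A B ij unfolding mult_mat_index_sum[OF A B ij(2,1)] cnj_sum
    by (intro sum.cong) auto
  also have "\<dots> = (mat_adjoint B * mat_adjoint A) $$ (i, j)"
    using A B ij by (subst mult_mat_index_sum[of _ q p _ n]) auto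
  finally show "mat_adjoint (A * B) $$ (i, j) = (mat_adjoint B * mat_adjoint A) $$ (i, j)" .
qed (use A B in auto)

section \<open>Unitary triangularisation\<close>

definition cunitary :: "nat \<Rightarrow> complex mat \<Rightarrow> bool" where
  "cunitary n U \<longleftrightarrow> U \<in> carrier_mat n n \<and> mat_adjoint U * U = 1\<^sub>m n \<and> U * mat_adjoint U = 1\<^sub>m n"

lemma cunitary_mult:
  assumes "cunitary n U" "cunitary n V"
  shows "cunitary n (U * V)"
proof -
  have c: "U \<in> carrier_mat n n" "V \<in> carrier_mat n n" using assms by (auto simp: cunitary_def)
  note a = mat_adjoint_carrier[OF c(1)] mat_adjoint_carrier[OF c(2)]
  have "mat_adjoint (U * V) * (U * V) = mat_adjoint V * ((mat_adjoint U * U) * V)"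
    using c a by (simp add: mat_adjoint_mult[OF c] assoc_mult_mat[of _ n n _ n _ n]
        mult_carrier_mat[of _ n n _ n])
  also have "\<dots> = 1\<^sub>m n" using assms c by (simp add: cunitary_def)
  finally have 1: "mat_adjoint (U * V) * (U * V) = 1\<^sub>m n" .
  have "(U * V) * mat_adjoint (U * V) = U * ((V * mat_adjoint V) * mat_adjoint U)"
    using c a by (simp add: mat_adjoint_mult[OF c] assoc_mult_mat[of _ n n _ n _ n]
        mult_carrier_mat[of _ n n _ n])
  also have "\<dots> = 1\<^sub>m n" using assms c a by (simp add: cunitary_def)
  finally show ?thesis using c 1 by (simp add: cunitary_def)
qed

text \<open>Gram-Schmidt as used below returns orthogonal vectors of arbitrary length; rescaling
  them makes the change of basis unitary.\<close>

definition normalize_vec :: "complex vec \<Rightarrow> complex vec" where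
  "normalize_vec v = complex_of_real (1 / sqrt (Re (v \<bullet>c v))) \<cdot>\<^sub>v v"

lemma cscalar_self: 
  "v \<bullet>c v = complex_of_real (\<Sum>i<dim_vec v. (cmod (v $ i))\<^sup>2)"
  by (auto simp: scalar_prod_def lessThan_atLeast0 conjugate_complex_def complex_norm_square
      simp del: of_real_power intro!: sum.cong)

lemma normalize_vec_carrier [simp]: "v \<in> carrier_vec n \<Longrightarrow> normalize_vec v \<in> carrier_vec n"
  unfolding normalize_vec_def by simp

lemma normalize_vec_cscalar:
  assumes "v \<in> carrier_vec n" "w \<in> carrier_vec n"
  shows "normalize_vec v \<bullet>c normalize_vec w =
     complex_of_real (1 / sqrt (Re (v \<bullet>c v)) * (1 / sqrt (Re (w \<bullet>c w)))) * (v \<bullet>c w)"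
  using assms unfolding normalize_vec_def
  by (simp add: conjugate_smult_vec conjugate_complex_def smult_scalar_prod_distrib[of _ n]
     scalar_prod_smult_distrib[of _ n])

lemma normalize_vec_cscalar_self:
  assumes "v \<in> carrier_vec n" "v \<bullet>c v \<noteq> 0"
  shows "normalize_vec v \<bullet>c normalize_vec v = 1"
proof -
  define S where "S = (\<Sum>i<dim_vec v. (cmod (v $ i))\<^sup>2)"
  have S: "v \<bullet>c v = complex_of_real S" unfolding S_def by (rule cscalar_self)
  then have "S \<noteq> 0" using assms by auto
  moreover have "S \<ge> 0" unfolding S_def by (intro sum_nonneg) auto
  ultimately have "S > 0" by simp
  then have "1 / sqrt S * (1 / sqrt S) * S = 1" by (simp add: field_simps)
  then show ?thesis
    unfolding normalize_vec_cscalar[OF assms(1) assms(1)] S 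
    by (simp only: Re_complex_of_real of_real_mult[symmetric] of_real_1)
qed

lemma corthogonal_normalize:
  assumes "set ws \<subseteq> carrier_vec n" "corthogonal ws"
  shows "corthogonal (map normalize_vec ws)"
    and "\<And>w. w \<in> set (map normalize_vec ws) \<Longrightarrow> w \<bullet>c w = 1"
proof -
  have c: "ws ! i \<in> carrier_vec n" if "i < length ws" for i using that assms by auto
  have nz: "ws ! i \<bullet>c ws ! i \<noteq> 0" if "i < length ws" for i
    using corthogonalD[OF assms(2) that that] by simp
  have one: "normalize_vec (ws ! i) \<bullet>c normalize_vec (ws ! i) = 1" if "i < length ws" for i
    using normalize_vec_cscalar_self[OF c nz] that by blast
  then show "\<And>w. w \<in> set (map normalize_vec ws) \<Longrightarrow> w \<bullet>c w = 1"
    by (auto simp: set_conv_nth)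
  show "corthogonal (map normalize_vec ws)"
  proof (rule corthogonalI)
    fix i j assume ij: "i < length (map normalize_vec ws)" "j < length (map normalize_vec ws)"
    show "(map normalize_vec ws ! i \<bullet>c map normalize_vec ws ! j = 0) = (i \<noteq> j)"
    proof (cases "i = j")
      case True
      then show ?thesis using one ij by simp
    next
      case False
      then have "ws ! i \<bullet>c ws ! j = 0" using corthogonalD[OF assms(2)] ij by simp
      then show ?thesis using False ij normalize_vec_cscalar[OF c c, of i j] by simp
    qed
  qed
qed

text \<open>The general inverse of a matrix with orthogonal columns divides each conjugated column
  by its squared length, and here all these lengths are 1.\<close>

lemma corthogonal_inv_normalized:
  fixes ws :: "complex vec list"
  assumes "set ws \<subseteq> carrier_vec n" "\<And>w. w \<in> set ws \<Longrightarrow> w \<bullet>c w = 1"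
  shows "corthogonal_inv (mat_of_cols n ws) = mat_adjoint (mat_of_cols n ws)"
proof -
  have "vec_inv w = conjugate w" if "w \<in> set ws" for w
    using assms(2)[OF that] by (simp add: vec_inv_def)
  then show ?thesis
    using assms(1) by (simp add: corthogonal_inv_def mat_adjoint_def cong: map_cong)
qed

lemma cunitary_four_block:
  assumes "cunitary n U"
  shows "cunitary (Suc n) (four_block_mat (1\<^sub>m 1) (0\<^sub>m 1 n) (0\<^sub>m n 1) U)"
    and "mat_adjoint (four_block_mat (1\<^sub>m 1) (0\<^sub>m 1 n) (0\<^sub>m n 1) U) =
         four_block_mat (1\<^sub>m 1) (0\<^sub>m 1 n) (0\<^sub>m n 1) (mat_adjoint U)"
proof -
  let ?V = "four_block_mat (1\<^sub>m 1) (0\<^sub>m 1 n) (0\<^sub>m n 1) U"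
  have U: "U \<in> carrier_mat n n" "mat_adjoint U * U = 1\<^sub>m n" "U * mat_adjoint U = 1\<^sub>m n"
    using assms by (auto simp: cunitary_def)
  have aU: "mat_adjoint U \<in> carrier_mat n n" using U by auto
  show adj: "mat_adjoint ?V = four_block_mat (1\<^sub>m 1) (0\<^sub>m 1 n) (0\<^sub>m n 1) (mat_adjoint U)"
    by (rule eq_matI) (use U in auto)
  have one: "four_block_mat (1\<^sub>m 1) (0\<^sub>m 1 n) (0\<^sub>m n 1) (1\<^sub>m n) = (1\<^sub>m (Suc n) :: complex mat)"
    by (rule eq_matI) auto
  have m: "four_block_mat (1\<^sub>m 1) (0\<^sub>m 1 n) (0\<^sub>m n 1) X * four_block_mat (1\<^sub>m 1) (0\<^sub>m 1 n) (0\<^sub>m n 1) Y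
      = four_block_mat (1\<^sub>m 1) (0\<^sub>m 1 n) (0\<^sub>m n 1) (X * Y)" 
    if "X \<in> carrier_mat n n" "Y \<in> carrier_mat n n" for X Y :: "complex mat"
    using that by (subst mult_four_block_mat[of _ 1 1 _ n _ n _ _ 1 _ n]) auto
  have "?V \<in> carrier_mat (Suc n) (Suc n)" using U by auto
  then show "cunitary (Suc n) ?V"
    unfolding cunitary_def adj m[OF aU U(1)] m[OF U(1) aU] U one by simp
qed

text \<open>Deflation: a unit eigenvector for the head \<open>e\<close> of the list is completed to
  a unitary matrix \<open>W\<close>, conjugation by \<open>W\<close> clears the first column below
  \<open>e\<close>, and the characteristic polynomial of the trailing block has the remaining list
  as its roots. Fixing the list in advance makes the diagonal carry each root with its
  multiplicity.\<close>

lemma unitary_schur_diagonal: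
  fixes A :: "complex mat"
  assumes "A \<in> carrier_mat n n" "char_poly A = (\<Prod>e\<leftarrow>es. [:- e, 1:])"
  shows "\<exists>U. cunitary n U \<and> length es = n \<and> (\<forall>i<n. (mat_adjoint U * A * U) $$ (i, i) = es ! i)"
  using assms
proof (induction es arbitrary: n A)
  case Nil
  then have "n = 0" using degree_monic_char_poly[of A n] by auto
  then show ?case by (intro exI[of _ "1\<^sub>m 0"]) (auto simp: cunitary_def intro!: eq_matI)
next
  case (Cons e es n A)
  note A = Cons.prems(1)
  have cp: "char_poly A = [:-e, 1:] * (\<Prod>e\<leftarrow>es. [:- e, 1:])" using Cons.prems by simp
  have mon: "monic (\<Prod>e\<leftarrow>es. [:- e, 1:])" by (rule monic_prod_list) auto
  have deg: "degree (char_poly A) = Suc (degree (\<Prod>e\<leftarrow>es. [:- e, 1:]))" 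
    unfolding cp using mon by (subst degree_mult_eq) auto
  with degree_monic_char_poly[OF A] obtain k where n: "n = Suc k" by (cases n) auto
  have "eigenvalue A e" unfolding eigenvalue_root_char_poly[OF A] cp by simp
  then obtain v0 where v0: "v0 \<in> carrier_vec n" "v0 \<noteq> 0\<^sub>v n" "A *\<^sub>v v0 = e \<cdot>\<^sub>v v0"
    using A unfolding eigenvalue_def eigenvector_def by auto
  interpret cof_vec_space n "TYPE(complex)" .
  define b where "b = basis_completion v0"
  from basis_completion[OF v0(1,2), folded b_def]
  have b: "distinct b" "\<not> lin_dep (set b)" "set b \<subseteq> carrier_vec n" "hd b = v0" "length b = n"
    by auto
  then obtain vs where bv: "b = v0 # vs" using n by (cases b) auto
  define ws0 where "ws0 = gram_schmidt n b"
  from gram_schmidt_result[OF b(3,1,2) ws0_def]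
  have ws0: "set ws0 \<subseteq> carrier_vec n" "corthogonal ws0" "length ws0 = n" 
    using b by auto
  have hd0: "hd ws0 = v0" using gram_schmidt_hd[OF v0(1)] by (simp add: ws0_def bv)
  define ws where "ws = map normalize_vec ws0"
  have ws: "set ws \<subseteq> carrier_vec n" "corthogonal ws" "length ws = n"
    and ws1: "\<And>w. w \<in> set ws \<Longrightarrow> w \<bullet>c w = 1"
    using ws0 corthogonal_normalize[OF ws0(1,2)] by (auto simp: ws_def)
  define v where "v = normalize_vec v0"
  have hd: "hd ws = v" using hd0 ws0(3) n by (cases ws0) (auto simp: ws_def v_def)
  then have vws: "v \<in> set ws" using ws(3) n by (cases ws) auto
  have v: "v \<in> carrier_vec n" using v0 by (simp add: v_def)
  have vn0: "v \<noteq> 0\<^sub>v n" using ws1[OF vws] by auto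
  have ev: "A *\<^sub>v v = e \<cdot>\<^sub>v v"
    unfolding v_def normalize_vec_def using A v0
    by (simp add: mult_mat_vec[of _ n n] smult_smult_assoc mult.commute)
  define W where "W = mat_of_cols n ws"
  have W: "W \<in> carrier_mat n n" using ws by (auto simp: W_def)
  have aW: "mat_adjoint W \<in> carrier_mat n n" using W by simp
  have inv: "corthogonal_inv W = mat_adjoint W"
    unfolding W_def by (rule corthogonal_inv_normalized[OF ws(1) ws1])
  have "inverts_mat (mat_adjoint W) W"
    using corthogonal_inv_result[OF orthogonal_mat_of_cols[OF ws]] inv by (simp add: W_def)
  then have WW: "mat_adjoint W * W = 1\<^sub>m n" using W by (simp add: inverts_mat_def)
  then have WW': "W * mat_adjoint W = 1\<^sub>m n" by (rule mat_mult_left_right_inverse[OF aW W])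
  have uW: "cunitary n W" using W WW WW' by (simp add: cunitary_def)
  define A' where "A' = mat_adjoint W * A * W"
  have A': "A' \<in> carrier_mat n n" using W A aW by (auto simp: A'_def)
  have col0: "col A' 0 = vec n (\<lambda>i. if i = 0 then e else 0)"
    using corthogonal_col_ev_0[OF A v vn0 ev _ hd ws] n inv by (simp add: A'_def W_def)
  obtain A1 A2 A0 A3 where sp: "split_block A' 1 1 = (A1,A2,A0,A3)"
    by (cases "split_block A' 1 1") auto
  have "dim_row A' = 1 + k" "dim_col A' = 1 + k" using A' n by auto
  from split_block[OF sp this]
  have A2: "A2 \<in> carrier_mat 1 k" and A3: "A3 \<in> carrier_mat k k"
    and A'b: "A' = four_block_mat A1 A2 A0 A3" by auto
  have A1id: "A1 = mat 1 1 (\<lambda>_. e)"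
    using sp[unfolded split_block_def Let_def] arg_cong[OF col0, of "\<lambda>v. v $ 0"] A' n
    by (auto simp: col_def)
  have A1: "A1 \<in> carrier_mat 1 1" by (auto simp: A1id)
  have "A' $$ (Suc i, 0) = 0" if "i < k" for i
    using arg_cong[OF col0, of "\<lambda>v. v $ Suc i"] A' that n by auto
  then have A0id: "A0 = 0\<^sub>m k 1"
    using sp[unfolded split_block_def Let_def] A' n by auto
  have "similar_mat_wit A' A (mat_adjoint W) W"
    by (rule similar_mat_witI[of _ _ n]) (use W aW A A' WW WW' in \<open>auto simp: A'_def\<close>)
  then have "similar_mat A' A" unfolding similar_mat_def by blast
  from char_poly_similar[OF this] cp
  have "char_poly A' = [:-e, 1:] * (\<Prod>e\<leftarrow>es. [:- e, 1:])" by simp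
  also have "char_poly A' = char_poly A1 * char_poly A3"
    unfolding A'b A0id by (rule char_poly_four_block_zeros_col[OF A1 A2 A3])
  also have "char_poly A1 = [:-e, 1:]"
    by (simp add: A1id char_poly_defs det_def sign_def)
  finally have "char_poly A3 = (\<Prod>e\<leftarrow>es. [:- e, 1:])"
    by (metis mult_cancel_left pCons_eq_0_iff zero_neq_one)
  from Cons.IH[OF A3 this] obtain V where V: "cunitary k V" and len: "length es = k"
    and diag: "\<And>i. i < k \<Longrightarrow> (mat_adjoint V * A3 * V) $$ (i, i) = es ! i" by blast
  have Vc: "V \<in> carrier_mat k k" "mat_adjoint V \<in> carrier_mat k k"
    using V by (auto simp: cunitary_def)
  \<comment> \<open>A leading 1 leaves the entry \<open>e\<close> and the zeros below it in place
    and conjugates only the trailing block.\<close>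
  define V' where "V' = four_block_mat (1\<^sub>m 1) (0\<^sub>m 1 k) (0\<^sub>m k 1) V"
  have uV': "cunitary n V'" and adjV': "mat_adjoint V' =
         four_block_mat (1\<^sub>m 1) (0\<^sub>m 1 k) (0\<^sub>m k 1) (mat_adjoint V)"
    using cunitary_four_block[OF V] by (auto simp: V'_def n)
  have V'c: "V' \<in> carrier_mat n n" "mat_adjoint V' \<in> carrier_mat n n"
    using uV' by (auto simp: cunitary_def)
  have "mat_adjoint (W * V') * A * (W * V') = mat_adjoint V' * A' * V'"
    using W aW A V'c unfolding A'_def mat_adjoint_mult[OF W V'c(1)]
    by (simp add: assoc_mult_mat[of _ n n _ n _ n] mult_carrier_mat[of _ n n _ n])
  also have "mat_adjoint V' * A' = four_block_mat A1 A2 (0\<^sub>m k 1) (mat_adjoint V * A3)"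
    unfolding adjV' A'b A0id using A1 A2 A3 Vc
    by (subst mult_four_block_mat[of _ 1 1 _ k _ k _ _ 1 _ k]) auto
  also have "\<dots> * V' = four_block_mat A1 (A2 * V) (0\<^sub>m k 1) (mat_adjoint V * A3 * V)"
    unfolding V'_def using A1 A2 A3 Vc
    by (subst mult_four_block_mat[of _ 1 1 _ k _ k _ _ 1 _ k]) auto
  finally have eq: "mat_adjoint (W * V') * A * (W * V') =
     four_block_mat A1 (A2 * V) (0\<^sub>m k 1) (mat_adjoint V * A3 * V)" .
  have "(mat_adjoint (W * V') * A * (W * V')) $$ (i, i) = (e # es) ! i" if "i < n" for i
  proof (cases i)
    case 0
    then show ?thesis using that A1 A2 A3 Vc unfolding eq by (simp add: A1id)
  next
    case (Suc j)
    then show ?thesis using that A1 A2 A3 Vc diag[of j] n unfolding eq by simp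
  qed
  with cunitary_mult[OF uW uV'] len n show ?case by (intro exI[of _ "W * V'"]) auto
qed

text \<open>\<open>trace_norm_mat\<close> sums over distinct roots weighted by their order, whereas
  the triangularisation yields a list with repetitions. The two agree because the order of a root is
  its number of occurrences in the list.\<close>

lemma sum_order_prod_linear:
  fixes es :: "complex list" and f :: "complex \<Rightarrow> real"
  defines "p \<equiv> (\<Prod>e\<leftarrow>es. [:- e, 1:])"
  shows "(\<Sum>z\<in>{z. poly p z = 0}. real (Polynomial.order z p) * f z) = (\<Sum>e\<leftarrow>es. f e)"
proof -
  have ord: "Polynomial.order z p = count_list es z" for z
    proof -
    have "Polynomial.order z p = (\<Sum>e\<leftarrow>es. Polynomial.order z [:- e, 1:])"
      unfolding p_def by (subst order_prod_list) (auto simp: o_def)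
    also have "\<dots> = count_list es z"
      by (induction es) (auto simp: order_linear')
    finally show ?thesis .
  qed
  have roots: "{z. poly p z = 0} = set es"
    unfolding p_def by (induction es) auto
  \<comment> \<open>\<open>S\<close> is an arbitrary finite superset, since \<open>set es\<close>
    itself changes during the induction.\<close>
  have *: "(\<Sum>z\<in>S. real (count_list es z) * f z) = (\<Sum>e\<leftarrow>es. f e)" if "finite S" "set es \<subseteq> S" for S
    using that(2)
  proof (induction es)
    case (Cons a es)
    have "(\<Sum>z\<in>S. real (count_list (a # es) z) * f z) =
          (\<Sum>z\<in>S. (if z = a then f z else 0) + real (count_list es z) * f z)"
      by (intro sum.cong) (auto simp: algebra_simps)
    also have "\<dots> = f a + (\<Sum>z\<in>S. real (count_list es z) * f z)"
      using Cons.prems that(1) by (simp add: sum.distrib)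
    finally show ?case using Cons by simp
  qed simp
  show ?thesis using *[of "set es"] unfolding ord roots by simp
qed

section \<open>Traces and Euclidean norms\<close>

definition mat_tr :: "complex mat \<Rightarrow> complex" where
  "mat_tr A = (\<Sum>i<dim_row A. A $$ (i, i))"

lemma mat_tr_comm:
  assumes "A \<in> carrier_mat n p" "B \<in> carrier_mat p n"
  shows "mat_tr (A * B) = mat_tr (B * A)"
proof -
  have "mat_tr (A * B) = (\<Sum>i<n. \<Sum>k<p. A $$ (i, k) * B $$ (k, i))"
    using assms by (auto simp: mat_tr_def mult_mat_index_sum[of A n p B n] simp del: index_mult_mat(1))
  also have "\<dots> = (\<Sum>k<p. \<Sum>i<n. B $$ (k, i) * A $$ (i, k))"
    by (subst sum.swap) (simp add: mult.commute)
  also have "\<dots> = mat_tr (B * A)"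
    using assms by (auto simp: mat_tr_def mult_mat_index_sum[of B p n A p] simp del: index_mult_mat(1))
  finally show ?thesis .
qed

definition vnorm :: "complex vec \<Rightarrow> real" where
  "vnorm v = L2_set (\<lambda>i. cmod (v $ i)) {..<dim_vec v}"

lemma vnorm_nonneg [simp]: "vnorm v \<ge> 0"
  by (simp add: vnorm_def)

lemma cscalar_vnorm: "v \<bullet>c v = complex_of_real ((vnorm v)\<^sup>2)"
  unfolding cscalar_self by (simp add: vnorm_def L2_set_def sum_nonneg)

lemma cauchy_schwarz_vnorm:
  assumes "v \<in> carrier_vec n" "w \<in> carrier_vec n"
  shows "cmod (w \<bullet>c v) \<le> vnorm w * vnorm v"
proof -
  have "cmod (w \<bullet>c v) \<le> (\<Sum>i<n. \<bar>cmod (w $ i)\<bar> * \<bar>cmod (v $ i)\<bar>)"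
    using assms by (auto simp: scalar_prod_def lessThan_atLeast0 conjugate_complex_def norm_mult
       intro!: sum_norm_le)
  also have "\<dots> \<le> vnorm w * vnorm v"
    using assms unfolding vnorm_def by (metis L2_set_mult_ineq carrier_vecD)
  finally show ?thesis .
qed

lemma adjoint_mult_index:
  fixes U :: "complex mat"
  assumes "U \<in> carrier_mat n p" "B \<in> carrier_mat n q" "i < p" "j < q"
  shows "(mat_adjoint U * B) $$ (i, j) = col B j \<bullet>c col U i"
proof -
  have "(mat_adjoint U * B) $$ (i, j) = (\<Sum>k<n. mat_adjoint U $$ (i, k) * B $$ (k, j))"
    by (rule mult_mat_index_sum) (use assms in auto)
  also have "\<dots> = col B j \<bullet>c col U i"
    using assms by (auto simp: scalar_prod_def lessThan_atLeast0 conjugate_complex_def intro!: sum.cong)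
  finally show ?thesis .
qed

text \<open>The unitary triangularisation of \<open>D\<^sup>* D\<close> suffices: its diagonal consists of the numbers
  \<open>\<parallel>D u\<^sub>i\<parallel>\<^sup>2\<close>, and the trace of \<open>Z D\<close> is evaluated in the basis \<open>u\<^sub>i\<close>.\<close>

lemma trace_norm_duality:
  assumes D: "D \<in> carrier_mat n n" and Z: "Z \<in> carrier_mat n n"
    and bd: "\<And>v. v \<in> carrier_vec n \<Longrightarrow> vnorm (Z *\<^sub>v v) \<le> \<kappa> * vnorm v"
  shows "cmod (mat_tr (Z * D)) \<le> \<kappa> * trace_norm_mat D"
proof -
  define H where "H = mat_adjoint D * D"
  have aD: "mat_adjoint D \<in> carrier_mat n n" using D by simp
  have H: "H \<in> carrier_mat n n" using D aD unfolding H_def by (rule mult_carrier_mat[rotated])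
  obtain es where es: "char_poly H = (\<Prod>e\<leftarrow>es. [:- e, 1:])"
    using char_poly_factorized[OF H] by blast
  obtain U where U: "cunitary n U" and len: "length es = n"
    and diag: "\<And>i. i < n \<Longrightarrow> (mat_adjoint U * H * U) $$ (i, i) = es ! i"
    using unitary_schur_diagonal[OF H es] by blast
  have Uc: "U \<in> carrier_mat n n" "mat_adjoint U \<in> carrier_mat n n"
    using U by (auto simp: cunitary_def)
  have DU: "D * U \<in> carrier_mat n n" using D Uc by simp
  have "sqrt (Re (es ! i)) = vnorm (D *\<^sub>v col U i)" if i: "i < n" for i
  proof -
    have "mat_adjoint U * H * U = mat_adjoint (D * U) * (D * U)"
      using Uc D aD unfolding mat_adjoint_mult[OF D Uc(1)] H_def
      by (simp add: assoc_mult_mat[of _ n n _ n _ n] mult_carrier_mat[of _ n n _ n])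
    then have "es ! i = (mat_adjoint (D * U) * (D * U)) $$ (i, i)" using diag[OF i] by simp
    also have "\<dots> = complex_of_real ((vnorm (col (D * U) i))\<^sup>2)"
      by (subst adjoint_mult_index[OF DU DU i i]) (rule cscalar_vnorm)
    also have "col (D * U) i = D *\<^sub>v col U i" using D Uc i by auto
    finally show ?thesis by simp
  qed
  then have tn: "trace_norm_mat D = (\<Sum>i<n. vnorm (D *\<^sub>v col U i))"
    unfolding trace_norm_mat_def Let_def H_def[symmetric] es sum_order_prod_linear
    by (simp add: sum_list_sum_nth len atLeast0LessThan)
  have ZD: "Z * D \<in> carrier_mat n n" using Z D by simp
  have ZDU: "Z * D * U \<in> carrier_mat n n" using ZD Uc by simp
  have u1: "vnorm (col U i) = 1" if i: "i < n" for i
  proof -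
    have "complex_of_real ((vnorm (col U i))\<^sup>2) = (mat_adjoint U * U) $$ (i, i)"
      by (subst adjoint_mult_index[OF Uc(1) Uc(1) i i]) (rule cscalar_vnorm[symmetric])
    also have "\<dots> = 1" using U i by (simp add: cunitary_def)
    finally have "(vnorm (col U i))\<^sup>2 = 1" by (simp only: of_real_eq_1_iff)
    then show ?thesis by (simp add: power2_eq_1_iff) (metis vnorm_nonneg neg_0_le_iff_le not_one_le_zero)
  qed
  have "mat_tr (Z * D) = mat_tr (Z * D * (U * mat_adjoint U))"
    using U right_mult_one_mat[OF ZD] by (simp add: cunitary_def)
  also have "\<dots> = mat_tr (Z * D * U * mat_adjoint U)"
    using ZD Uc by (simp add: assoc_mult_mat[of _ n n _ n _ n] mult_carrier_mat[of _ n n _ n])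
  also have "\<dots> = mat_tr (mat_adjoint U * (Z * D * U))"
    by (rule mat_tr_comm[OF ZDU Uc(2)])
  also have "\<dots> = (\<Sum>i<n. col (Z * D * U) i \<bullet>c col U i)"
    using Uc ZDU by (auto simp: mat_tr_def adjoint_mult_index[of U n n _ n] simp del: index_mult_mat(1) intro!: sum.cong)
  finally have "cmod (mat_tr (Z * D)) \<le> (\<Sum>i<n. cmod (col (Z * D * U) i \<bullet>c col U i))"
    by (simp add: norm_sum)
  also have "\<dots> \<le> (\<Sum>i<n. \<kappa> * vnorm (D *\<^sub>v col U i))"
  proof (rule sum_mono)
    fix i assume "i \<in> {..<n}"
    then have i: "i < n" by simp
    have uc: "col U i \<in> carrier_vec n" using Uc i by auto
    have c: "col (Z * D * U) i = Z *\<^sub>v (D *\<^sub>v col U i)"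
      using Z D Uc i ZD by (metis assoc_mult_mat_vec carrier_matD(2) col_mult2 uc)
    have "cmod (col (Z * D * U) i \<bullet>c col U i) \<le> vnorm (Z *\<^sub>v (D *\<^sub>v col U i)) * vnorm (col U i)"
      unfolding c by (rule cauchy_schwarz_vnorm) (use Z D uc in auto)
    also have "\<dots> \<le> \<kappa> * vnorm (D *\<^sub>v col U i)" unfolding u1[OF i]
      using bd[of "D *\<^sub>v col U i"] D uc by auto
    finally show "cmod (col (Z * D * U) i \<bullet>c col U i) \<le> \<kappa> * vnorm (D *\<^sub>v col U i)" .
  qed
  also have "\<dots> = \<kappa> * trace_norm_mat D" by (simp add: tn sum_distrib_left)
  finally show ?thesis .
qed

section \<open>Matrix products as path sums\<close>

text \<open>Condition (2) of H(\<alpha>) at one fixed \<open>n\<close>: \<gamma> stands for a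
  constant divided by \<open>n powr \<alpha>\<close>, so every later dependence on \<open>n\<close>
  can be read off from \<gamma>.\<close>

definition decays :: "imat \<Rightarrow> real \<Rightarrow> real \<Rightarrow> bool" where
  "decays A C \<gamma> \<longleftrightarrow> C \<ge> 0 \<and> \<gamma> > 0 \<and> (\<forall>r s. cmod (A r s) \<le> C * exp (- \<gamma> * \<bar>real r - real s\<bar>))"

abbreviation lists_len :: "nat \<Rightarrow> nat list set" where
  "lists_len m \<equiv> {xs. length xs = m}"

fun path_weight :: "imat \<Rightarrow> nat \<Rightarrow> nat list \<Rightarrow> complex" where
  "path_weight A r [] = 1"
| "path_weight A r (x # xs) = A r x * path_weight A x xs"

fun path_var :: "nat \<Rightarrow> nat list \<Rightarrow> real" where
  "path_var r [] = 0"
| "path_var r (x # xs) = \<bar>real r - real x\<bar> + path_var x xs"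

text \<open>The i-th function acts on the point reached by the i-th step, as a diagonal matrix
  standing after the i-th factor would. The default 1 is the empty product; the lists that matter
  have equal length.\<close>

fun path_mask :: "(nat \<Rightarrow> complex) list \<Rightarrow> nat list \<Rightarrow> complex" where
  "path_mask (f # fs) (x # xs) = f x * path_mask fs xs"
| "path_mask _ _ = 1"

lemma path_var_nonneg: "path_var r xs \<ge> 0"
  by (induction xs arbitrary: r) (auto simp: add_nonneg_nonneg)

lemma path_var_ge_start: "u \<in> set xs \<Longrightarrow> \<bar>real r - real u\<bar> \<le> path_var r xs"
proof (induction xs arbitrary: r)
  case (Cons x xs)
  show ?case
  proof (cases "u = x")
    case True
    then show ?thesis using path_var_nonneg[of x xs] by simp
  next
    case False
    then have "\<bar>real x - real u\<bar> \<le> path_var x xs" using Cons by simp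
    then show ?thesis by simp
  qed
qed simp

text \<open>Triangle inequality along the part of the path between the two visits. It converts a far
  excursion into a lower bound for the exponent in \<open>path_weight_le\<close>.\<close>

lemma path_var_ge:
  "\<lbrakk>u \<in> set (r # xs); v \<in> set (r # xs)\<rbrakk> \<Longrightarrow> \<bar>real u - real v\<bar> \<le> path_var r xs"
proof (induction xs arbitrary: r)
  case (Cons x xs)
  show ?case
  proof (cases "u = r \<or> v = r")
    case True
    moreover have "\<bar>real r - real w\<bar> \<le> path_var r (x # xs)" if "w \<in> set (r # x # xs)" for w
      using that path_var_ge_start[of w "x # xs" r] path_var_nonneg[of r "x # xs"] by auto
    ultimately show ?thesis using Cons.prems by (metis abs_minus_commute)
  next
    case False
    then have "\<bar>real u - real v\<bar> \<le> path_var x xs" using Cons by auto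
    then show ?thesis by simp
  qed
qed simp

lemma path_weight_le:
  assumes "decays A C \<gamma>"
  shows "cmod (path_weight A r xs) \<le> C ^ length xs * exp (- \<gamma> * path_var r xs)"
proof (induction xs arbitrary: r)
  case (Cons x xs)
  have "cmod (path_weight A r (x # xs)) \<le>
     (C * exp (- \<gamma> * \<bar>real r - real x\<bar>)) * (C ^ length xs * exp (- \<gamma> * path_var x xs))"
    using assms Cons by (auto simp: decays_def norm_mult intro!: mult_mono)
  also have "\<dots> = C ^ length (x # xs) * exp (- \<gamma> * path_var r (x # xs))"
    by (simp add: exp_add[symmetric] algebra_simps flip: exp_add)
  finally show ?case .
qed simp

section \<open>Summability over paths\<close>

definition kernel_sum :: "real \<Rightarrow> real" where
  "kernel_sum \<gamma> = 2 / (1 - exp (- \<gamma>))"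

text \<open>Two geometric series, one on each side of \<open>r\<close>, each at most
  \<open>1 / (1 - exp (- \<gamma>))\<close>. That the bound does not depend on \<open>r\<close> is
  what allows iteration along a path.\<close>

lemma exp_kernel_summable:
  assumes "\<gamma> > 0"
  shows "(\<lambda>s. exp (- \<gamma> * \<bar>real r - real s\<bar>)) summable_on UNIV"
    and "(\<Sum>\<^sub>\<infinity>s. exp (- \<gamma> * \<bar>real r - real s\<bar>)) \<le> kernel_sum \<gamma>"
proof -
  let ?f = "\<lambda>s. exp (- \<gamma> * \<bar>real r - real s\<bar>)"
  define q where "q = exp (- \<gamma>)"
  have q: "0 < q" "q < 1" using assms by (auto simp: q_def)
  have pow: "q ^ k = exp (- \<gamma> * real k)" for k
    by (simp add: q_def exp_of_nat_mult[symmetric] mult.commute)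
  have geo: "(\<Sum>k\<in>S. q ^ k) \<le> 1 / (1 - q)" if "finite S" for S :: "nat set"
    using sum_le_suminf[of "\<lambda>k. q ^ k" S] that q suminf_geometric[of q] by (simp add: summable_geometric)
  have bound: "(\<Sum>s\<in>F. ?f s) \<le> kernel_sum \<gamma>" if F: "finite F" for F
  proof -
    have "(\<Sum>s\<in>F. ?f s) = (\<Sum>s\<in>F \<inter> {..r}. ?f s) + (\<Sum>s\<in>F - {..r}. ?f s)"
      using F by (rule sum.Int_Diff)
    also have "(\<Sum>s\<in>F \<inter> {..r}. ?f s) = (\<Sum>s\<in>F \<inter> {..r}. q ^ (r - s))"
      by (intro sum.cong) (auto simp: pow of_nat_diff)
    also have "\<dots> = (\<Sum>k\<in>(\<lambda>s. r - s) ` (F \<inter> {..r}). q ^ k)"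
      by (subst sum.reindex) (auto simp: inj_on_def)
    also have "\<dots> \<le> 1 / (1 - q)" using F by (intro geo) auto
    also have "(\<Sum>s\<in>F - {..r}. ?f s) = (\<Sum>s\<in>F - {..r}. q ^ (s - r))"
      by (intro sum.cong) (auto simp: pow of_nat_diff)
    also have "\<dots> = (\<Sum>k\<in>(\<lambda>s. s - r) ` (F - {..r}). q ^ k)"
      by (subst sum.reindex) (auto simp: inj_on_def)
    also have "\<dots> \<le> 1 / (1 - q)" using F by (intro geo) auto
    finally show ?thesis by (simp add: kernel_sum_def q_def)
  qed
  show s: "?f summable_on UNIV"
    by (rule nonneg_bdd_above_summable_on) (use bound in \<open>auto intro!: bdd_aboveI2\<close>)
  show "(\<Sum>\<^sub>\<infinity>s. ?f s) \<le> kernel_sum \<gamma>"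
    using s bound by (intro infsum_le_finite_sums) auto
qed

lemma lists_len_Suc_bij:
  "bij_betw (\<lambda>(x, xs). x # xs) (UNIV \<times> lists_len m) (lists_len (Suc m))"
  by (rule bij_betwI[of _ _ _ "\<lambda>xs. (hd xs, tl xs)"]) (auto simp: length_Suc_conv)

text \<open>Summing over the tail before the first point, each step contributes one factor
  \<open>kernel_sum \<gamma>\<close>, wherever it starts.\<close>

lemma path_kernel_summable:
  assumes "\<gamma> > 0"
  shows "(\<lambda>xs. exp (- \<gamma> * path_var r xs)) summable_on lists_len m \<and>
     (\<Sum>\<^sub>\<infinity>xs\<in>lists_len m. exp (- \<gamma> * path_var r xs)) \<le> kernel_sum \<gamma> ^ m"
proof (induction m arbitrary: r)
  case 0
  then show ?case by simp
next
  case (Suc m)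
  let ?f = "\<lambda>r xs. exp (- \<gamma> * path_var r xs)"
  let ?h = "\<lambda>(x, xs). ?f r (x # xs)"
  let ?I = "\<lambda>x. \<Sum>\<^sub>\<infinity>xs\<in>lists_len m. ?f x xs"
  let ?k = "\<lambda>x. exp (- \<gamma> * \<bar>real r - real x\<bar>)"
  have k0: "kernel_sum \<gamma> ^ m \<ge> 0" using assms by (simp add: kernel_sum_def)
  have inner: "((\<lambda>xs. ?h (x, xs)) has_sum (?k x * ?I x)) (lists_len m)" for x
  proof -
    have "((\<lambda>xs. ?k x * ?f x xs) has_sum (?k x * ?I x)) (lists_len m)"
      using Suc[of x] by (intro has_sum_cmult_right has_sum_infsum) blast
    then show ?thesis by (simp add: ring_distribs exp_add mult_exp_exp)
  qed
  have sk: "(\<lambda>x. ?k x * kernel_sum \<gamma> ^ m) summable_on UNIV"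
    by (intro summable_on_cmult_left exp_kernel_summable assms)
  have le: "?k x * ?I x \<le> ?k x * kernel_sum \<gamma> ^ m" for x
    using Suc[of x] by simp
  have sI: "(\<lambda>x. ?k x * ?I x) summable_on UNIV"
    by (rule summable_on_comparison_test[OF sk]) (use le in \<open>auto intro!: mult_nonneg_nonneg infsum_nonneg\<close>)
  have sh: "?h summable_on (UNIV \<times> lists_len m)"
    by (rule summable_on_SigmaI[OF inner sI]) auto
  have "(?h has_sum (\<Sum>\<^sub>\<infinity>x. ?k x * ?I x)) (UNIV \<times> lists_len m)"
    by (rule has_sum_SigmaI[OF inner has_sum_infsum[OF sI] sh])
  then have "((\<lambda>p. ?f r ((\<lambda>(x, xs). x # xs) p)) has_sum (\<Sum>\<^sub>\<infinity>x. ?k x * ?I x)) (UNIV \<times> lists_len m)"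
    by (simp add: case_prod_unfold)
  then have hs: "(?f r has_sum (\<Sum>\<^sub>\<infinity>x. ?k x * ?I x)) (lists_len (Suc m))"
    using has_sum_reindex_bij_betw[OF lists_len_Suc_bij[of m], where f = "?f r"] by blast
  have "(\<Sum>\<^sub>\<infinity>x. ?k x * ?I x) \<le> (\<Sum>\<^sub>\<infinity>x. ?k x * kernel_sum \<gamma> ^ m)"
    by (rule infsum_mono[OF sI sk]) (use le in auto)
  also have "\<dots> = (\<Sum>\<^sub>\<infinity>x. ?k x) * kernel_sum \<gamma> ^ m"
    by (intro infsum_cmult_left exp_kernel_summable assms)
  also have "\<dots> \<le> kernel_sum \<gamma> * kernel_sum \<gamma> ^ m"
    by (intro mult_right_mono exp_kernel_summable assms k0)
  finally show ?case using hs by (simp add: infsumI has_sum_imp_summable)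
qed

text \<open>Provides the convergence behind every later splitting and subtraction of path sums, for
  any bounded coefficient \<open>g\<close>.\<close>

lemma path_sum_abs_summable:
  assumes "decays A C \<gamma>" "\<And>xs. cmod (g xs) \<le> M"
  shows "(\<lambda>xs. norm (path_weight A r xs * g xs)) summable_on lists_len m"
proof (rule Infinite_Sum.abs_summable_on_comparison_test')
  have "\<gamma> > 0" using assms by (simp add: decays_def)
  then show "(\<lambda>xs. (C ^ m * M) * exp (- \<gamma> * path_var r xs)) summable_on lists_len m"
    using path_kernel_summable by (intro summable_on_cmult_right) blast
  fix xs :: "nat list" assume xs: "xs \<in> lists_len m"
  have "cmod (path_weight A r xs * g xs) \<le> (C ^ m * exp (- \<gamma> * path_var r xs)) * M"
    unfolding norm_mult using assms xs path_weight_le[OF assms(1), of r xs]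
    by (intro mult_mono) (auto simp: decays_def)
  then show "norm (path_weight A r xs * g xs) \<le> (C ^ m * M) * exp (- \<gamma> * path_var r xs)"
    by (simp add: mult_ac)
qed

lemma infsum_lists_len_Suc:
  fixes h :: "nat list \<Rightarrow> complex"
  assumes "h summable_on lists_len (Suc m)"
  shows "infsum h (lists_len (Suc m)) = (\<Sum>\<^sub>\<infinity>x. \<Sum>\<^sub>\<infinity>xs\<in>lists_len m. h (x # xs))"
    and "(\<lambda>x. \<Sum>\<^sub>\<infinity>xs\<in>lists_len m. h (x # xs)) summable_on UNIV"
proof -
  let ?h = "\<lambda>(x, xs). h (x # xs)"
  have eq: "?h = (\<lambda>p. h ((\<lambda>(x, xs). x # xs) p))" by (auto simp: fun_eq_iff)
  have s: "?h summable_on (UNIV \<times> lists_len m)"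
    unfolding eq using assms summable_on_reindex_bij_betw[OF lists_len_Suc_bij, of h m] by blast
  have "infsum h (lists_len (Suc m)) = infsum ?h (UNIV \<times> lists_len m)"
    unfolding eq using infsum_reindex_bij_betw[OF lists_len_Suc_bij, of h m] by simp
  also have "\<dots> = (\<Sum>\<^sub>\<infinity>x. \<Sum>\<^sub>\<infinity>xs\<in>lists_len m. h (x # xs))"
    using infsum_Sigma'_banach[of "\<lambda>x xs. h (x # xs)"] s by simp
  finally show "infsum h (lists_len (Suc m)) = (\<Sum>\<^sub>\<infinity>x. \<Sum>\<^sub>\<infinity>xs\<in>lists_len m. h (x # xs))" .
  show "(\<lambda>x. \<Sum>\<^sub>\<infinity>xs\<in>lists_len m. h (x # xs)) summable_on UNIV"
    using summable_on_Sigma_banach[of "\<lambda>x xs. h (x # xs)" UNIV "\<lambda>_. lists_len m"] s by simp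
qed

section \<open>Products with diagonal factors\<close>

definition masked :: "(nat \<Rightarrow> complex) list \<Rightarrow> bool" where
  "masked fs \<longleftrightarrow> (\<forall>f\<in>set fs. \<forall>x. cmod (f x) \<le> 1)"

lemma path_mask_le: "masked fs \<Longrightarrow> cmod (path_mask fs xs) \<le> 1"
proof (induction fs xs rule: path_mask.induct)
  case (1 f fs x xs)
  then show ?case by (auto simp: masked_def norm_mult intro!: mult_le_one)
qed auto

text \<open>The entries of the product A F1 A F2 ... A Fm, where Fi is the diagonal matrix of the
  i-th function. The indicator prescribes the end point; for the empty list it produces the
  identity, since \<open>last [r]\<close> is \<open>r\<close>.\<close>

definition chain :: "imat \<Rightarrow> (nat \<Rightarrow> complex) list \<Rightarrow> imat" where
  "chain A fs r s = (\<Sum>\<^sub>\<infinity>xs\<in>lists_len (length fs).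
      path_weight A r xs * (path_mask fs xs * (if last (r # xs) = s then 1 else 0)))"

lemma chain_Nil: "chain A [] = ident"
  by (auto simp: chain_def ident_def fun_eq_iff)

lemma chain_summable:
  assumes "decays A C \<gamma>" "masked fs"
  shows "(\<lambda>xs. path_weight A r xs * (path_mask fs xs * (if last (r # xs) = s then 1 else 0)))
    summable_on lists_len m"
  by (rule abs_summable_summable, rule path_sum_abs_summable[OF assms(1), where M = 1])
     (use path_mask_le[OF assms(2)] in auto)

text \<open>Splits off the first step of the path. The convergence in the second part is needed
  later to exchange this series with a finite sum.\<close>

lemma chain_Cons:
  assumes "decays A C \<gamma>" "masked (f # fs)"
  shows "chain A (f # fs) r s = (\<Sum>\<^sub>\<infinity>k. A r k * (f k * chain A fs k s))"
    and "(\<lambda>k. A r k * (f k * chain A fs k s)) summable_on UNIV"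
proof -
  let ?h = "\<lambda>xs. path_weight A r xs * (path_mask (f # fs) xs * (if last (r # xs) = s then 1 else 0))"
  have s: "?h summable_on lists_len (Suc (length fs))"
    by (rule chain_summable[OF assms])
  have "masked fs" using assms(2) by (simp add: masked_def)
  have inner: "(\<Sum>\<^sub>\<infinity>xs\<in>lists_len (length fs). ?h (k # xs)) = A r k * (f k * chain A fs k s)" for k
  proof -
    have "(\<Sum>\<^sub>\<infinity>xs\<in>lists_len (length fs). ?h (k # xs)) = (\<Sum>\<^sub>\<infinity>xs\<in>lists_len (length fs). (A r k * f k) *
       (path_weight A k xs * (path_mask fs xs * (if last (k # xs) = s then 1 else 0))))"
      by (intro infsum_cong) (simp add: mult_ac)
    also have "\<dots> = (A r k * f k) * chain A fs k s"
      unfolding chain_def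
      by (intro infsum_cmult_right chain_summable[OF assms(1) \<open>masked fs\<close>])
    finally show ?thesis by (simp add: mult_ac)
  qed
  show "chain A (f # fs) r s = (\<Sum>\<^sub>\<infinity>k. A r k * (f k * chain A fs k s))"
    using infsum_lists_len_Suc(1)[OF s] unfolding inner by (simp add: chain_def)
  show "(\<lambda>k. A r k * (f k * chain A fs k s)) summable_on UNIV"
    using infsum_lists_len_Suc(2)[OF s] unfolding inner .
qed

lemma mpow_eq_chain:
  assumes "decays A C \<gamma>"
  shows "mpow A l = chain A (replicate l (\<lambda>_. 1))"
proof (induction l)
  case 0
  then show ?case by (simp add: chain_Nil)
next
  case (Suc l)
  have "masked ((\<lambda>_. 1) # replicate l (\<lambda>_. 1))" by (auto simp: masked_def)
  from chain_Cons(1)[OF assms this] show ?case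
    by (simp add: mmult_def Suc fun_eq_iff)
qed

lemma infsum_single:
  fixes f :: "'a \<Rightarrow> 'b::{comm_monoid_add, t2_space}"
  assumes "\<And>k. k \<noteq> i \<Longrightarrow> f k = 0"
  shows "(\<Sum>\<^sub>\<infinity>k. f k) = f i"
proof -
  have "(\<Sum>\<^sub>\<infinity>k. f k) = infsum f {i}"
    by (rule infsum_cong_neutral) (use assms in auto)
  then show ?thesis by simp
qed

lemma mmult_Pk: "mmult X (Pk (int n)) r s = (if s < n then X r s else 0)"
  unfolding mmult_def by (subst infsum_single[of s]) (auto simp: Pk_def)

definition below :: "nat \<Rightarrow> nat \<Rightarrow> complex" where
  "below n x = (if x < n then 1 else 0)"

lemma mmult_mmult_Pk:
  "mmult (mmult X (Pk (int n))) M r s = (\<Sum>k<n. X r k * M k s)"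
proof -
  have "mmult (mmult X (Pk (int n))) M r s = (\<Sum>\<^sub>\<infinity>k\<in>{..<n}. X r k * M k s)"
    unfolding mmult_def[of _ M] mmult_Pk by (rule infsum_cong_neutral) auto
  then show ?thesis by simp
qed

lemma has_sum_finite_sum:
  fixes f :: "'a \<Rightarrow> 'b \<Rightarrow> complex"
  assumes "finite I" "\<And>i. i \<in> I \<Longrightarrow> (\<lambda>x. f x i) summable_on X"
  shows "((\<lambda>x. \<Sum>i\<in>I. f x i) has_sum (\<Sum>i\<in>I. \<Sum>\<^sub>\<infinity>x\<in>X. f x i)) X"
  using assms by (induction I) (auto intro!: has_sum_add has_sum_infsum)

text \<open>The one instance of associativity that is required. The projection makes the sum over
  \<open>k\<close> finite, so regrouping only exchanges a finite sum with a convergent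
  series.\<close>

lemma mpow_Pk_chain:
  assumes "decays A C \<gamma>" "masked fs"
  shows "(\<Sum>k<n. mpow A (Suc l) r k * chain A fs k s) =
     chain A (replicate l (\<lambda>_. 1) @ below n # fs) r s"
proof (induction l arbitrary: r)
  case step: 0
  have "masked (below n # fs)" using assms by (auto simp: masked_def below_def)
  from chain_Cons(1)[OF assms(1) this]
  have "chain A (below n # fs) r s = (\<Sum>\<^sub>\<infinity>k. A r k * (below n k * chain A fs k s))" .
  also have "\<dots> = (\<Sum>\<^sub>\<infinity>k\<in>{..<n}. A r k * chain A fs k s)"
    by (rule infsum_cong_neutral) (auto simp: below_def)
  moreover have "mpow A (Suc 0) r k = A r k" for k
    by (simp add: mmult_def ident_def, subst infsum_single[of k]) auto
  ultimately show ?case by simp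
next
  case (Suc l)
  let ?F = "replicate l (\<lambda>_. 1) @ below n # fs"
  have m: "masked ((\<lambda>_. 1) # ?F)" using assms by (auto simp: masked_def below_def)
  have m1: "masked ((\<lambda>_. 1) # replicate (Suc l) (\<lambda>_. 1))" by (auto simp: masked_def)
  have s: "(\<lambda>q. A r q * mpow A (Suc l) q k * chain A fs k s) summable_on UNIV" for k
    using chain_Cons(2)[OF assms(1) m1, of r k] unfolding mpow_eq_chain[OF assms(1)]
    by (intro summable_on_cmult_left) simp
  have "(\<Sum>k<n. mpow A (Suc (Suc l)) r k * chain A fs k s) =
        (\<Sum>k<n. \<Sum>\<^sub>\<infinity>q. A r q * mpow A (Suc l) q k * chain A fs k s)"
    unfolding mpow.simps(2)[of A "Suc l"] mmult_def[of A "mpow A (Suc l)"]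
    by (intro sum.cong refl infsum_cmult_left' [symmetric])
  also have "\<dots> = (\<Sum>\<^sub>\<infinity>q. \<Sum>k<n. A r q * mpow A (Suc l) q k * chain A fs k s)"
    using s by (intro infsumI[symmetric] has_sum_finite_sum) auto
  also have "\<dots> = (\<Sum>\<^sub>\<infinity>q. A r q * chain A ?F q s)"
    by (simp only: Suc.IH[symmetric] sum_distrib_left mult.assoc)
  also have "\<dots> = chain A ((\<lambda>_. 1) # ?F) r s"
    using chain_Cons(1)[OF assms(1) m, of r s] by simp
  finally show ?case by simp
qed

text \<open>A block A^l P_n consists of \<open>l\<close> factors, of which only the last is followed
  by the projection; the others carry the trivial mask. For \<open>l \<ge> 1\<close> the block thus
  occupies exactly \<open>l\<close> places.\<close>

definition masks :: "nat \<Rightarrow> nat list \<Rightarrow> (nat \<Rightarrow> complex) list" where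
  "masks n ls = concat (map (\<lambda>l. replicate (l - 1) (\<lambda>_. 1) @ [below n]) ls)"

lemma masked_masks: "masked (masks n ls)"
  by (auto simp: masked_def masks_def below_def)

lemma length_masks: "\<forall>l\<in>set ls. l \<ge> 1 \<Longrightarrow> length (masks n ls) = sum_list ls"
  by (induction ls) (auto simp: masks_def)

lemma prodP_eq_chain:
  assumes "decays A C \<gamma>" "\<forall>l\<in>set ls. l \<ge> 1"
  shows "prodP n A ls = chain A (masks n ls)"
  using assms(2)
proof (induction ls)
  case Nil
  then show ?case by (simp add: prodP_def masks_def chain_Nil)
next
  case (Cons l ls)
  then obtain l' where l: "l = Suc l'" by (cases l) auto
  have "prodP n A (l # ls) = mmult (mmult (mpow A l) (Pk (int n))) (chain A (masks n ls))"
    using Cons by (simp add: prodP_def)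
  then show ?case
    unfolding fun_eq_iff mmult_mmult_Pk l mpow_Pk_chain[OF assms(1) masked_masks]
    by (simp add: masks_def)
qed

section \<open>Trace differences as sums over closed paths\<close>

lemma has_sum_diff:
  fixes f g :: "'a \<Rightarrow> complex"
  assumes "(f has_sum a) X" "(g has_sum b) X"
  shows "((\<lambda>x. f x - g x) has_sum (a - b)) X"
  using has_sum_add[OF assms(1) has_sum_uminusI[OF assms(2)]] by simp

text \<open>The trace of (A F1 ... A Fm - A^m) P_n, written over a common set of closed paths. For
  masks built from 1 and \<open>below n\<close>, the coefficient \<open>path_mask fs xs - 1\<close>
  vanishes on every path that stays below \<open>n\<close>.\<close>

definition crossing_sum :: "nat \<Rightarrow> imat \<Rightarrow> (nat \<Rightarrow> complex) list \<Rightarrow> complex" where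
  "crossing_sum n A fs = (\<Sum>i<n. \<Sum>\<^sub>\<infinity>xs\<in>lists_len (length fs).
      path_weight A i xs * ((path_mask fs xs - 1) * (if last (i # xs) = i then 1 else 0)))"

lemma path_mask_ones: "path_mask (replicate m (\<lambda>_. 1)) xs = 1"
proof (induction m arbitrary: xs)
  case (Suc m)
  then show ?case by (cases xs) auto
qed simp

lemma crossing_sum_eq_chain:
  assumes "decays A C \<gamma>" "masked fs"
  shows "crossing_sum n A fs = (\<Sum>i<n. chain A fs i i) - (\<Sum>i<n. chain A (replicate (length fs) (\<lambda>_. 1)) i i)"
proof -
  let ?L = "lists_len (length fs)"
  have m1: "masked (replicate (length fs) (\<lambda>_. 1))" by (auto simp: masked_def)
  have "(\<Sum>\<^sub>\<infinity>xs\<in>?L. path_weight A i xs * ((path_mask fs xs - 1) * (if last (i # xs) = i then 1 else 0)))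
     = chain A fs i i - chain A (replicate (length fs) (\<lambda>_. 1)) i i" for i
    using has_sum_diff[OF has_sum_infsum[OF chain_summable[OF assms]]
        has_sum_infsum[OF chain_summable[OF assms(1) m1]]]
    by (intro infsumI) (simp add: chain_def path_mask_ones algebra_simps)
  then show ?thesis by (simp add: crossing_sum_def sum_subtractf)
qed

lemma path_mask_zero_last:
  assumes "length xs = length fs" "fs \<noteq> []" "last fs (last xs) = 0"
  shows "path_mask fs xs = 0"
  using assms
proof (induction fs xs rule: path_mask.induct)
  case (1 f fs x xs)
  then show ?case by (cases fs; cases xs) auto
qed auto

text \<open>The last mask of a composition is \<open>below n\<close>, so a closed path based at
  \<open>i \<ge> n\<close> has mask 0. Both traces are therefore sums over \<open>i < n\<close> and
  can be compared path by path.\<close>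

lemma trace_difference_eq_crossing_sum:
  assumes A: "decays A C \<gamma>" and ls: "ls \<in> compositions m j" and "m \<ge> 1"
  shows "mtrace (prodP n A ls) - mtrace (mmult (mpow A m) (Pk (int n))) = crossing_sum n A (masks n ls)"
    and "length (masks n ls) = m"
proof -
  have ls1: "\<forall>l\<in>set ls. l \<ge> 1" and sum: "sum_list ls = m"
    using ls by (auto simp: compositions_def)
  show len: "length (masks n ls) = m" using length_masks[OF ls1] sum by simp
  have "ls \<noteq> []" using sum \<open>m \<ge> 1\<close> by auto
  then have last: "last (masks n ls) = below n"
    by (induction ls rule: rev_induct) (auto simp: masks_def)
  have ne: "masks n ls \<noteq> []" using len \<open>m \<ge> 1\<close> by auto
  have "chain A (masks n ls) i i = 0" if "i \<ge> n" for i
    unfolding chain_def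
  proof (rule infsum_0)
    fix xs :: "nat list" assume xs: "xs \<in> lists_len (length (masks n ls))"
    then have "xs \<noteq> []" using ne by auto
    then have "path_mask (masks n ls) xs = 0" if "last (i # xs) = i"
      using xs ne last that \<open>i \<ge> n\<close> by (intro path_mask_zero_last) (auto simp: below_def)
    then show "path_weight A i xs * (path_mask (masks n ls) xs * (if last (i # xs) = i then 1 else 0)) = 0"
      by simp
  qed
  then have "mtrace (prodP n A ls) = (\<Sum>\<^sub>\<infinity>i\<in>{..<n}. chain A (masks n ls) i i)"
    unfolding mtrace_def prodP_eq_chain[OF A ls1]
    by (intro infsum_cong_neutral) (auto simp: not_less)
  moreover have "mtrace (mmult (mpow A m) (Pk (int n))) = (\<Sum>\<^sub>\<infinity>i\<in>{..<n}. mpow A m i i)"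
    unfolding mtrace_def mmult_Pk by (intro infsum_cong_neutral) auto
  ultimately show "mtrace (prodP n A ls) - mtrace (mmult (mpow A m) (Pk (int n))) = crossing_sum n A (masks n ls)"
    by (simp add: crossing_sum_eq_chain[OF A masked_masks] len mpow_eq_chain[OF A])
qed

section \<open>Localization to a window\<close>

definition window :: "(nat \<Rightarrow> bool) \<Rightarrow> imat \<Rightarrow> imat" where
  "window w A r s = (if w r \<and> w s then A r s else 0)"

lemma decays_window: "decays A C \<gamma> \<Longrightarrow> decays (window w A) C \<gamma>"
  by (auto simp: decays_def window_def)

lemma path_weight_window:
  "xs \<noteq> [] \<Longrightarrow> path_weight (window w A) r xs =
     (if \<forall>x\<in>set (r # xs). w x then path_weight A r xs else 0)"
proof (induction xs arbitrary: r)
  case (Cons x xs)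
  then show ?case by (cases xs) (auto simp: window_def)
qed simp

lemma path_mask_below_cases:
  "\<forall>f\<in>set fs. f = (\<lambda>_. 1) \<or> f = below n \<Longrightarrow> path_mask fs xs = 0 \<or> path_mask fs xs = 1"
proof (induction fs xs rule: path_mask.induct)
  case (1 f fs x xs)
  then show ?case by (cases "x < n") (auto simp: below_def)
qed auto

lemma path_mask_below_eq_1:
  "\<lbrakk>\<forall>f\<in>set fs. f = (\<lambda>_. 1) \<or> f = below n; \<forall>x\<in>set xs. x < n\<rbrakk> \<Longrightarrow> path_mask fs xs = 1"
  by (induction fs xs rule: path_mask.induct) (auto simp: below_def)

text \<open>A path contributing to the difference starts below \<open>n\<close> and visits a point that is at
  least \<open>n\<close>, so leaving the window costs it a total variation of at least \<open>L\<close>.\<close>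

lemma crossing_sum_window:
  assumes A: "decays A C (2 * \<gamma>)" and "fs \<noteq> []"
    and fs: "\<forall>f\<in>set fs. f = (\<lambda>_. 1) \<or> f = below n"
    and w: "\<And>x. \<not> w x \<Longrightarrow> real x \<le> real n - L \<or> real x \<ge> real n + L"
  shows "cmod (crossing_sum n A fs - crossing_sum n (window w A) fs)
     \<le> real n * (C ^ length fs * exp (- \<gamma> * L) * kernel_sum \<gamma> ^ length fs)"
proof -
  define m where "m = length fs"
  let ?g = "\<lambda>i xs. (path_mask fs xs - 1) * (if last (i # xs) = i then 1 else 0)"
  let ?S = "\<lambda>A i. \<Sum>\<^sub>\<infinity>xs\<in>lists_len m. path_weight A i xs * ?g i xs"
  have \<gamma>: "\<gamma> > 0" and C: "C \<ge> 0" using A by (auto simp: decays_def)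
  have g: "cmod (?g i xs) \<le> 1" for i xs
    using path_mask_below_cases[OF fs, of xs] by auto
  have s: "(\<lambda>xs. path_weight B i xs * ?g i xs) summable_on lists_len m" if "decays B C (2 * \<gamma>)" for B i
    by (rule abs_summable_summable, rule path_sum_abs_summable[OF that g])
  have "cmod (?S A i - ?S (window w A) i) \<le> C ^ m * exp (- \<gamma> * L) * kernel_sum \<gamma> ^ m" if i: "i < n" for i
  proof -
    let ?K = "C ^ m * exp (- \<gamma> * L)"
    have 1: "((\<lambda>xs. path_weight A i xs * ?g i xs - path_weight (window w A) i xs * ?g i xs)
        has_sum (?S A i - ?S (window w A) i)) (lists_len m)"
      by (intro has_sum_diff has_sum_infsum s A decays_window)
    have 2: "((\<lambda>xs. ?K * exp (- \<gamma> * path_var i xs)) has_sum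
        (?K * (\<Sum>\<^sub>\<infinity>xs\<in>lists_len m. exp (- \<gamma> * path_var i xs)))) (lists_len m)"
      using path_kernel_summable[OF \<gamma>] by (intro has_sum_cmult_right has_sum_infsum) blast
    have "cmod (?S A i - ?S (window w A) i) \<le> ?K * (\<Sum>\<^sub>\<infinity>xs\<in>lists_len m. exp (- \<gamma> * path_var i xs))"
    proof (rule norm_infsum_le[OF 1 2])
      fix xs :: "nat list" assume "xs \<in> lists_len m"
      then have len: "length xs = m" and ne: "xs \<noteq> []" using \<open>fs \<noteq> []\<close> by (auto simp: m_def)
      let ?D = "path_weight A i xs * ?g i xs - path_weight (window w A) i xs * ?g i xs"
      show "cmod ?D \<le> ?K * exp (- \<gamma> * path_var i xs)"
      \<comment> \<open>The terms cancel on a path inside the window, where the weights agree, and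
        vanish on a path that stays below \<open>n\<close>, where the coefficient is 0. Any other
        path has a point \<open>v\<close> outside the window and a point
        \<open>u \<ge> n\<close>.\<close>
      proof (cases "(\<forall>x\<in>set (i # xs). w x) \<or> (\<forall>x\<in>set xs. x < n)")
        case True
        then have "path_weight (window w A) i xs = path_weight A i xs \<or> path_mask fs xs = 1"
          using path_weight_window[OF ne, of w A i] path_mask_below_eq_1[OF fs, of xs] by auto
        then have "?D = 0" by (elim disjE) simp_all
        then show ?thesis using C by (simp only: norm_zero) simp
      next
        case False
        then obtain v u where v: "v \<in> set (i # xs)" "\<not> w v" and u: "u \<in> set xs" "u \<ge> n"
          by (auto simp: not_less)
        have "L \<le> path_var i xs"
        \<comment> \<open>If \<open>v\<close> lies to the left of the window, it is compared with
          \<open>u \<ge> n\<close>; if it lies to the right, with the starting point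
          \<open>i < n\<close>. Either distance is at least \<open>L\<close>.\<close>
        proof (cases "real v \<le> real n - L")
          case True
          then show ?thesis using path_var_ge[of u i xs v] u v by auto
        next
          case False
          then show ?thesis using w[OF v(2)] path_var_ge[of v i xs i] v i by auto
        qed
        then have "\<gamma> * L \<le> \<gamma> * path_var i xs" using \<gamma> by simp
        then have e: "exp (- (2 * \<gamma>) * path_var i xs) \<le> exp (- \<gamma> * L) * exp (- \<gamma> * path_var i xs)"
          by (simp add: mult_exp_exp)
        have "?D = path_weight A i xs * ?g i xs" using False path_weight_window[OF ne, of w A i] by auto
        also have "cmod \<dots> \<le> cmod (path_weight A i xs) * 1"
          unfolding norm_mult using g[of xs i] by (intro mult_left_mono) (auto simp: norm_mult)
        also have "\<dots> \<le> C ^ m * exp (- (2 * \<gamma>) * path_var i xs)"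
          using path_weight_le[OF A, of i xs] len by simp
        also have "\<dots> \<le> C ^ m * (exp (- \<gamma> * L) * exp (- \<gamma> * path_var i xs))"
          using e C by (intro mult_left_mono) auto
        finally show ?thesis by (simp add: mult_ac)
      qed
    qed
    also have "\<dots> \<le> ?K * kernel_sum \<gamma> ^ m"
      using C path_kernel_summable[OF \<gamma>] by (intro mult_left_mono) auto
    finally show ?thesis .
  qed
  then have "cmod (\<Sum>i<n. ?S A i - ?S (window w A) i) \<le>
     (\<Sum>i<n. C ^ m * exp (- \<gamma> * L) * kernel_sum \<gamma> ^ m)"
    by (intro sum_norm_le) auto
  then show ?thesis by (simp add: crossing_sum_def sum_subtractf m_def)
qed

section \<open>Products of compressed matrices\<close>

definition op_bounded :: "nat \<Rightarrow> real \<Rightarrow> complex mat \<Rightarrow> bool" where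
  "op_bounded N \<kappa> Z \<longleftrightarrow> Z \<in> carrier_mat N N \<and> (\<forall>v\<in>carrier_vec N. vnorm (Z *\<^sub>v v) \<le> \<kappa> * vnorm v)"

definition diagm :: "nat \<Rightarrow> (nat \<Rightarrow> complex) \<Rightarrow> complex mat" where
  "diagm N f = mat N N (\<lambda>(i, j). if i = j then f i else 0)"

definition corner :: "nat \<Rightarrow> imat \<Rightarrow> complex mat" where
  "corner N A = mat N N (\<lambda>(i, j). A i j)"

lemma diagm_carrier [simp]: "diagm N f \<in> carrier_mat N N"
  by (simp add: diagm_def)

lemma corner_carrier [simp]: "corner N A \<in> carrier_mat N N"
  by (simp add: corner_def)

lemma diagm_dim [simp]: "dim_row (diagm N f) = N" "dim_col (diagm N f) = N"
  by (simp_all add: diagm_def)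

lemma mult_mat_vec_index_sum:
  assumes "A \<in> carrier_mat n p" "v \<in> carrier_vec p" "i < n"
  shows "(A *\<^sub>v v) $ i = (\<Sum>k<p. A $$ (i, k) * v $ k)"
  using assms by (auto simp: scalar_prod_def lessThan_atLeast0 intro!: sum.cong)

lemma op_bounded_mult:
  assumes "op_bounded N \<kappa> Z" "op_bounded N \<mu> Y" "\<kappa> \<ge> 0"
  shows "op_bounded N (\<kappa> * \<mu>) (Z * Y)"
proof -
  have c: "Z \<in> carrier_mat N N" "Y \<in> carrier_mat N N" using assms by (auto simp: op_bounded_def)
  have "vnorm ((Z * Y) *\<^sub>v v) \<le> \<kappa> * \<mu> * vnorm v" if v: "v \<in> carrier_vec N" for v
  proof -
    have "(Z * Y) *\<^sub>v v = Z *\<^sub>v (Y *\<^sub>v v)" using c v by (rule assoc_mult_mat_vec)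
    moreover have "vnorm (Z *\<^sub>v (Y *\<^sub>v v)) \<le> \<kappa> * vnorm (Y *\<^sub>v v)"
      using assms(1) c v by (simp add: op_bounded_def)
    moreover have "\<kappa> * vnorm (Y *\<^sub>v v) \<le> \<kappa> * (\<mu> * vnorm v)"
      using assms v by (intro mult_left_mono) (auto simp: op_bounded_def)
    ultimately show ?thesis by (simp add: mult.assoc)
  qed
  then show ?thesis using c by (auto simp: op_bounded_def)
qed

lemma diagm_mult_index:
  assumes "M \<in> carrier_mat N N" "i < N" "j < N"
  shows "(diagm N f * M) $$ (i, j) = f i * M $$ (i, j)"
proof -
  have "(diagm N f * M) $$ (i, j) = (\<Sum>k<N. (if i = k then f i * M $$ (k, j) else 0))"
    by (subst mult_mat_index_sum[OF diagm_carrier assms])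
       (rule sum.cong[OF refl], use assms in \<open>auto simp: diagm_def\<close>)
  then show ?thesis using assms by simp
qed

lemma op_bounded_diagm:
  assumes "\<And>x. cmod (f x) \<le> 1"
  shows "op_bounded N 1 (diagm N f)"
proof -
  have "vnorm (diagm N f *\<^sub>v v) \<le> vnorm v" if v: "v \<in> carrier_vec N" for v
  proof -
    have "(diagm N f *\<^sub>v v) $ i = f i * v $ i" if i: "i < N" for i
    proof -
      have "(diagm N f *\<^sub>v v) $ i = (\<Sum>k<N. (if i = k then f i * v $ k else 0))"
        by (subst mult_mat_vec_index_sum[OF diagm_carrier v i])
           (rule sum.cong[OF refl], use i in \<open>auto simp: diagm_def\<close>)
      then show ?thesis using i by simp
    qed
    then have "cmod ((diagm N f *\<^sub>v v) $ i) \<le> cmod (v $ i)" if "i < N" for i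
      using that assms[of i] by (simp add: norm_mult mult_left_le_one_le)
    moreover have "dim_vec (diagm N f *\<^sub>v v) = N" by (simp add: diagm_def)
    ultimately show ?thesis using v by (auto simp: vnorm_def intro!: L2_set_mono)
  qed
  then show ?thesis by (auto simp: op_bounded_def)
qed

text \<open>Finite counterpart of \<open>chain\<close>, as a genuine matrix product to which norm
  bounds and cyclicity of the trace apply.\<close>

fun fchain :: "nat \<Rightarrow> complex mat \<Rightarrow> (nat \<Rightarrow> complex) list \<Rightarrow> complex mat" where
  "fchain N a [] = 1\<^sub>m N"
| "fchain N a (f # fs) = a * (diagm N f * fchain N a fs)"

lemma op_bounded_one: "op_bounded N 1 (1\<^sub>m N)"
  by (simp add: op_bounded_def)

lemma op_bounded_fchain:
  assumes "op_bounded N K a" "K \<ge> 0" "masked fs"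
  shows "op_bounded N (K ^ length fs) (fchain N a fs)"
  using assms(3)
proof (induction fs)
  case (Cons f fs)
  then have "op_bounded N 1 (diagm N f)" "op_bounded N (K ^ length fs) (fchain N a fs)"
    by (auto simp: masked_def intro!: op_bounded_diagm)
  from op_bounded_mult[OF assms(1) op_bounded_mult[OF this]] assms(2) show ?case by simp
qed (simp add: op_bounded_one)

lemma mat_tr_mult_diff:
  assumes "Y \<in> carrier_mat N N" "a \<in> carrier_mat N N" "b \<in> carrier_mat N N"
  shows "mat_tr (Y * b) - mat_tr (Y * a) = mat_tr (Y * (b - a))"
proof -
  have "Y * (b - a) = Y * b - Y * a"
    using assms by (intro mult_minus_distrib_mat)
  then show ?thesis
    using assms by (simp add: mat_tr_def sum_subtractf del: index_mult_mat(1))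
qed

text \<open>Duality tested on the zero matrix with bound 1. The sign is not evident from the
  definition, since \<open>sqrt\<close> is negative at negative arguments.\<close>

lemma trace_norm_nonneg:
  assumes "D \<in> carrier_mat N N"
  shows "trace_norm_mat D \<ge> 0"
proof -
  have "op_bounded N 1 (diagm N (\<lambda>_. 0))" by (rule op_bounded_diagm) simp
  then have "cmod (mat_tr (diagm N (\<lambda>_. 0) * D)) \<le> 1 * trace_norm_mat D"
    using assms by (intro trace_norm_duality) (auto simp: op_bounded_def)
  then show ?thesis by (smt (verit) norm_ge_zero)
qed

text \<open>Telescoping: once the leading \<open>a\<close> is exchanged for \<open>b\<close>, that
  \<open>b\<close> and its diagonal factor are absorbed into \<open>Z\<close> and a shorter product
  remains. This is why \<open>Z\<close> and \<kappa> are arbitrary. Each of the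
  \<open>length fs\<close> exchanges costs at most one trace norm times
  \<open>\<kappa> * K ^ length fs\<close>.\<close>

lemma fchain_trace_diff:
  assumes a: "op_bounded N K a" and b: "op_bounded N K b" and K: "K \<ge> 1"
    and "masked fs" "op_bounded N \<kappa> Z" "\<kappa> \<ge> 0"
  shows "cmod (mat_tr (Z * fchain N b fs) - mat_tr (Z * fchain N a fs))
    \<le> \<kappa> * (real (length fs) * K ^ length fs) * trace_norm_mat (b - a)"
  using assms(4-)
proof (induction fs arbitrary: \<kappa> Z)
  case (Cons f fs)
  let ?F = "diagm N f" and ?A = "fchain N a fs" and ?B = "fchain N b fs" and ?t = "trace_norm_mat (b - a)"
  have m: "masked fs" using Cons.prems by (simp add: masked_def)
  have oF: "op_bounded N 1 ?F" using Cons.prems by (intro op_bounded_diagm) (auto simp: masked_def)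
  have oA: "op_bounded N (K ^ length fs) ?A" and oB: "op_bounded N (K ^ length fs) ?B"
    using K m by (auto intro!: op_bounded_fchain a b)
  have c: "a \<in> carrier_mat N N" "b \<in> carrier_mat N N" "?F \<in> carrier_mat N N" "?A \<in> carrier_mat N N"
     "?B \<in> carrier_mat N N" "Z \<in> carrier_mat N N"
    using a b oF oA oB Cons.prems by (auto simp: op_bounded_def)
  note cs = c mult_carrier_mat[of _ N N _ N] assoc_mult_mat[of _ N N _ N _ N]
  have t0: "?t \<ge> 0" using c by (intro trace_norm_nonneg) auto
  have oZ: "op_bounded N (\<kappa> * K) (Z * b * ?F)"
    using op_bounded_mult[OF op_bounded_mult[OF Cons.prems(2) b Cons.prems(3)] oF] K Cons.prems(3) by simp
  have 1: "cmod (mat_tr (Z * b * ?F * ?B) - mat_tr (Z * b * ?F * ?A))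
     \<le> (\<kappa> * K) * (real (length fs) * K ^ length fs) * ?t"
    using K Cons.prems by (intro Cons.IH[OF m oZ]) auto
  \<comment> \<open>Cyclicity moves everything except the difference \<open>b - a\<close> to its
    left, which is the form required by the duality bound.\<close>
  let ?Y = "?F * ?A * Z"
  have oY: "op_bounded N (K ^ length fs * \<kappa>) ?Y"
    using op_bounded_mult[OF op_bounded_mult[OF oF oA] Cons.prems(2)] K by simp
  have "cmod (mat_tr (?Y * (b - a))) \<le> K ^ length fs * \<kappa> * ?t"
    using oY c(1,2) unfolding op_bounded_def by (intro trace_norm_duality[of _ N]) (auto simp del: assoc_mult_mat)
  \<comment> \<open>One surplus factor \<open>K \<ge> 1\<close> is spent so that all exchanges have
    the same cost.\<close>
  also have "\<dots> \<le> K ^ Suc (length fs) * \<kappa> * ?t"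
    using K Cons.prems t0 by (intro mult_right_mono) (auto simp: mult_le_cancel_right1)
  finally have 2: "cmod (mat_tr (?Y * (b - a))) \<le> K ^ Suc (length fs) * \<kappa> * ?t" .
  have cyc: "mat_tr (?Y * x) = mat_tr (Z * (x * (?F * ?A)))" if x: "x \<in> carrier_mat N N" for x
  proof -
    have "mat_tr (?F * ?A * (Z * x)) = mat_tr (Z * x * (?F * ?A))"
      using c x by (intro mat_tr_comm[of _ N N]) (auto simp: mult_carrier_mat[of _ N N _ N])
    then show ?thesis using c x by (simp add: cs)
  qed
  have "mat_tr (Z * fchain N b (f # fs)) - mat_tr (Z * fchain N a (f # fs)) =
     (mat_tr (Z * b * ?F * ?B) - mat_tr (Z * b * ?F * ?A)) + mat_tr (?Y * (b - a))"
  proof -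
    have Y: "?Y \<in> carrier_mat N N" using oY by (simp only: op_bounded_def)
    have d: "mat_tr (?Y * (b - a)) = mat_tr (Z * (b * (?F * ?A))) - mat_tr (Z * (a * (?F * ?A)))"
      by (simp only: mat_tr_mult_diff[OF Y c(1,2), symmetric] cyc[OF c(1)] cyc[OF c(2)])
    have e: "Z * b * ?F * X = Z * (b * (?F * X))" if "X \<in> carrier_mat N N" for X
      using c that by (simp add: cs)
    show ?thesis unfolding d e[OF c(4)] e[OF c(5)] fchain.simps by simp
  qed
  then have "cmod (mat_tr (Z * fchain N b (f # fs)) - mat_tr (Z * fchain N a (f # fs)))
    \<le> (\<kappa> * K) * (real (length fs) * K ^ length fs) * ?t + K ^ Suc (length fs) * \<kappa> * ?t"
    using 1 2 by (smt (verit) norm_triangle_ineq)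
  also have "\<dots> = \<kappa> * (real (length (f # fs)) * K ^ length (f # fs)) * ?t"
    by (simp add: algebra_simps)
  finally show ?case .
qed simp

text \<open>The vanishing columns confine every step of a contributing path to indices below
  \<open>N\<close>, so each infinite sum is a finite matrix product.\<close>

lemma fchain_eq_chain:
  assumes d: "decays a C \<gamma>" and z: "\<And>r k. k \<ge> N \<Longrightarrow> a r k = 0"
    and "masked fs" "i < N" "j < N"
  shows "fchain N (corner N a) fs \<in> carrier_mat N N \<and> fchain N (corner N a) fs $$ (i, j) = chain a fs i j"
  using assms(3-)
proof (induction fs arbitrary: i)
  case Nil
  then show ?case by (simp add: chain_Nil ident_def)
next
  case (Cons f fs)
  let ?M = "fchain N (corner N a) fs"
  have m: "masked fs" using Cons.prems by (simp add: masked_def)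
  have M: "?M \<in> carrier_mat N N" using Cons.IH[OF m Cons.prems(2,3)] by simp
  have "chain a (f # fs) i j = (\<Sum>\<^sub>\<infinity>k. a i k * (f k * chain a fs k j))"
    by (rule chain_Cons(1)[OF d Cons.prems(1)])
  also have "\<dots> = (\<Sum>\<^sub>\<infinity>k\<in>{..<N}. a i k * (f k * chain a fs k j))"
    by (rule infsum_cong_neutral) (auto simp: z)
  also have "\<dots> = (\<Sum>k<N. corner N a $$ (i, k) * (diagm N f * ?M) $$ (k, j))"
    using Cons M m by (auto simp: corner_def diagm_mult_index simp del: index_mult_mat(1) intro!: sum.cong)
  also have "\<dots> = fchain N (corner N a) (f # fs) $$ (i, j)"
    using Cons.prems M by (simp add: mult_mat_index_sum[of _ N N _ N] mult_carrier_mat[of _ N N _ N] del: index_mult_mat(1))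
  finally show ?case using M by (simp add: mult_carrier_mat[of _ N N _ N])
qed

text \<open>Compression by coordinate projections does not increase the norm. The absolute value
  appears because \<open>op_norm_le\<close> sees only the square of its constant, which may be
  negative.\<close>

lemma op_bounded_corner_window:
  assumes A: "op_norm_le A K0" and w: "\<And>x. w x \<Longrightarrow> x < N" and K: "\<bar>K0\<bar> \<le> K"
  shows "op_bounded N K (corner N (window w A))"
proof -
  let ?M = "corner N (window w A)"
  have "vnorm (?M *\<^sub>v v) \<le> K * vnorm v" if v: "v \<in> carrier_vec N" for v
  proof -
    \<comment> \<open>The vector is cut to the window and extended by zero to a sequence in
      \<open>ell2\<close>.\<close>
    define x where "x = (\<lambda>i. if i < N \<and> w i then v $ i else 0)"
    have sx: "((\<lambda>i. (cmod (x i))\<^sup>2) has_sum (\<Sum>i<N. (cmod (x i))\<^sup>2)) UNIV"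
      by (rule has_sum_finite_neutralI[of "{..<N}"]) (auto simp: x_def)
    have "ell2 x" unfolding ell2_def using sx by (rule has_sum_imp_summable)
    with A have e: "ell2 (mat_vec A x)"
      and le: "(\<Sum>\<^sub>\<infinity>r. (cmod (mat_vec A x r))\<^sup>2) \<le> K0\<^sup>2 * (\<Sum>\<^sub>\<infinity>i. (cmod (x i))\<^sup>2)"
      unfolding op_norm_le_def by blast+
    have xv: "(\<Sum>i<N. (cmod (x i))\<^sup>2) \<le> (vnorm v)\<^sup>2"
      using v by (auto simp: vnorm_def L2_set_def sum_nonneg x_def intro!: sum_mono)
    have comp: "(?M *\<^sub>v v) $ r = (if w r then mat_vec A x r else 0)" if r: "r < N" for r
    proof -
      have "mat_vec A x r = (\<Sum>\<^sub>\<infinity>s\<in>{..<N}. A r s * x s)"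
        unfolding mat_vec_def by (rule infsum_cong_neutral) (auto simp: x_def)
      then show ?thesis
        unfolding mult_mat_vec_index_sum[OF corner_carrier v r] using r
        by (auto simp: corner_def window_def x_def intro!: sum.cong sum.neutral)
    qed
    have "(vnorm (?M *\<^sub>v v))\<^sup>2 = (\<Sum>r<N. (cmod ((?M *\<^sub>v v) $ r))\<^sup>2)"
      by (simp add: vnorm_def L2_set_def sum_nonneg corner_def)
    also have "\<dots> \<le> (\<Sum>r<N. (cmod (mat_vec A x r))\<^sup>2)"
      by (intro sum_mono) (auto simp: comp simp del: index_mult_mat_vec)
    also have "\<dots> \<le> (\<Sum>\<^sub>\<infinity>r. (cmod (mat_vec A x r))\<^sup>2)"
      using e by (intro finite_sum_le_infsum) (auto simp: ell2_def)
    also have "\<dots> \<le> K0\<^sup>2 * (\<Sum>i<N. (cmod (x i))\<^sup>2)"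
      using le infsumI[OF sx] by simp
    also have "\<dots> \<le> K0\<^sup>2 * (vnorm v)\<^sup>2" using xv by (intro mult_left_mono) auto
    also have "\<dots> \<le> K\<^sup>2 * (vnorm v)\<^sup>2" using K by (intro mult_right_mono) (auto simp flip: abs_le_square_iff)
    finally have "(vnorm (?M *\<^sub>v v))\<^sup>2 \<le> (K * vnorm v)\<^sup>2" by (simp add: power_mult_distrib)
    then show ?thesis using K by (intro power2_le_imp_le[of "vnorm (?M *\<^sub>v v)"]) auto
  qed
  then show ?thesis by (auto simp: op_bounded_def)
qed

text \<open>The factor 2 arises because the masked product and the plain power are each compared
  separately.\<close>

lemma crossing_sum_diff_le:
  assumes dA: "decays A C \<gamma>" and dB: "decays B C \<gamma>"
    and oA: "op_norm_le A KA" "\<bar>KA\<bar> \<le> K" and oB: "op_norm_le B KB" "\<bar>KB\<bar> \<le> K" and K: "K \<ge> 1"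
    and w: "\<And>x. w x \<Longrightarrow> x < N" and n: "n \<le> N" and fs: "masked fs"
  shows "cmod (crossing_sum n (window w B) fs - crossing_sum n (window w A) fs) \<le>
     2 * (real (length fs) * K ^ length fs) * trace_norm_mat (corner N (window w (\<lambda>r s. B r s - A r s)))"
proof -
  let ?a = "corner N (window w A)" and ?b = "corner N (window w B)"
  let ?ones = "replicate (length fs) (\<lambda>_::nat. 1::complex)"
  \<comment> \<open>Multiplying by P_n turns the partial trace over \<open>i < n\<close> into a full
    trace in dimension \<open>N\<close>.\<close>
  let ?Z = "diagm N (below n)"
  have ones: "masked ?ones" by (auto simp: masked_def)
  have tr: "(\<Sum>i<n. chain (window w X) gs i i) = mat_tr (?Z * fchain N (corner N (window w X)) gs)"
    if X: "decays X C \<gamma>" and gs: "masked gs" for X gs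
  proof -
    have fc: "fchain N (corner N (window w X)) gs \<in> carrier_mat N N \<and>
       fchain N (corner N (window w X)) gs $$ (i, i) = chain (window w X) gs i i" if "i < N" for i
      by (rule fchain_eq_chain[OF decays_window[OF X] _ gs that that]) (auto simp: window_def dest: w)
    have "mat_tr (?Z * fchain N (corner N (window w X)) gs) =
      (\<Sum>i<N. if i < n then chain (window w X) gs i i else 0)"
      unfolding mat_tr_def
      by (rule sum.cong) (auto simp: diagm_mult_index fc below_def simp del: index_mult_mat(1))
    also have "\<dots> = (\<Sum>i<n. chain (window w X) gs i i)"
      using n by (intro sum.mono_neutral_cong_right) auto
    finally show ?thesis by simp
  qed
  have oZ: "op_bounded N 1 ?Z" by (rule op_bounded_diagm) (auto simp: below_def)
  have a: "op_bounded N K ?a" and b: "op_bounded N K ?b"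
    using op_bounded_corner_window[OF oA(1) w oA(2)] op_bounded_corner_window[OF oB(1) w oB(2)] by blast+
  have D: "corner N (window w (\<lambda>r s. B r s - A r s)) = ?b - ?a"
    by (rule eq_matI) (auto simp: corner_def window_def)
  have bd: "cmod (mat_tr (?Z * fchain N ?b gs) - mat_tr (?Z * fchain N ?a gs))
    \<le> 1 * (real (length gs) * K ^ length gs) * trace_norm_mat (?b - ?a)" if "masked gs" for gs
    by (rule fchain_trace_diff[OF a b K that oZ]) simp
  have eq: "crossing_sum n (window w B) fs - crossing_sum n (window w A) fs =
     (mat_tr (?Z * fchain N ?b fs) - mat_tr (?Z * fchain N ?a fs)) -
     (mat_tr (?Z * fchain N ?b ?ones) - mat_tr (?Z * fchain N ?a ?ones))"
    unfolding crossing_sum_eq_chain[OF decays_window[OF dA] fs] crossing_sum_eq_chain[OF decays_window[OF dB] fs]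
    by (simp add: tr[OF dA fs] tr[OF dB fs] tr[OF dA ones] tr[OF dB ones])
  have "cmod (crossing_sum n (window w B) fs - crossing_sum n (window w A) fs) \<le>
     cmod (mat_tr (?Z * fchain N ?b fs) - mat_tr (?Z * fchain N ?a fs)) +
     cmod (mat_tr (?Z * fchain N ?b ?ones) - mat_tr (?Z * fchain N ?a ?ones))"
    unfolding eq by (rule norm_triangle_ineq4)
  also have "\<dots> \<le> 1 * (real (length fs) * K ^ length fs) * trace_norm_mat (?b - ?a) +
     1 * (real (length fs) * K ^ length fs) * trace_norm_mat (?b - ?a)"
    by (rule add_mono[OF bd[OF fs] bd[OF ones, unfolded length_replicate]])
  also have "\<dots> = 2 * (real (length fs) * K ^ length fs) * trace_norm_mat (?b - ?a)"
    by (simp only: mult_2 distrib_right mult_1)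
  finally show ?thesis unfolding D .
qed

section \<open>The comparison theorem\<close>

text \<open>From \<open>1 + \<gamma> \<le> exp \<gamma>\<close>. For \<gamma> of order
  \<open>1 / n powr \<alpha>\<close> each step of a path costs only a factor of order
  \<open>n powr \<alpha>\<close>.\<close>

lemma kernel_sum_le:
  assumes "\<gamma> > 0"
  shows "0 \<le> kernel_sum \<gamma>" "kernel_sum \<gamma> \<le> 2 * (1 + 1 / \<gamma>)"
proof -
  have "exp (- \<gamma>) \<le> 1 / (1 + \<gamma>)"
    using assms exp_ge_add_one_self[of \<gamma>] by (simp add: exp_minus field_simps)
  then have le: "\<gamma> / (1 + \<gamma>) \<le> 1 - exp (- \<gamma>)" using assms by (simp add: field_simps)
  moreover have pos: "0 < \<gamma> / (1 + \<gamma>)" using assms by simp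
  ultimately have "2 / (1 - exp (- \<gamma>)) \<le> 2 / (\<gamma> / (1 + \<gamma>))"
    using assms by (intro divide_left_mono mult_pos_pos) auto
  then show "kernel_sum \<gamma> \<le> 2 * (1 + 1 / \<gamma>)" using assms by (simp add: kernel_sum_def field_simps)
  show "0 \<le> kernel_sum \<gamma>" using assms by (simp add: kernel_sum_def)
qed

lemma powr_times_exp_tendsto_0:
  fixes p c \<delta> :: real
  assumes "c > 0" "\<delta> > 0"
  shows "(\<lambda>n. real n powr p * exp (- c * real n powr \<delta>)) \<longlonglongrightarrow> 0"
  using assms by real_asymp

text \<open>The \<open>n\<close> starting points and the \<open>m\<close> kernel sums grow like the
  power \<open>1 + \<alpha> * m\<close> of \<open>n\<close>, while the exponent is
  \<open>- 2 * m * c * n powr (\<beta> - \<alpha>)\<close>, which diverges because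
  \<open>\<alpha> < \<beta>\<close>.\<close>

lemma localization_error_tendsto_0:
  fixes \<alpha> \<beta> c C :: real and m :: nat
  assumes "0 < \<alpha>" "\<alpha> < \<beta>" "c > 0" "C \<ge> 0" "m \<ge> 1"
  defines "\<gamma> \<equiv> \<lambda>n. c / real n powr \<alpha>"
  shows "(\<lambda>n. real n * (C ^ m * exp (- \<gamma> n * (2 * real m * real n powr \<beta>)) * kernel_sum (\<gamma> n) ^ m))
     \<longlonglongrightarrow> 0"
proof (rule Lim_null_comparison)
  define M where "M = C ^ m * (2 * (1 + 1 / c)) ^ m"
  define f where "f = (\<lambda>n::nat. M * (real n powr (1 + \<alpha> * real m) *
      exp (- (2 * real m * c) * real n powr (\<beta> - \<alpha>))))"
  have "f \<longlonglongrightarrow> M * 0"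
    unfolding f_def using assms by (intro tendsto_mult_left powr_times_exp_tendsto_0) auto
  then show "f \<longlonglongrightarrow> 0" by simp
  have bound: "norm (real n * (C ^ m * exp (- \<gamma> n * (2 * real m * real n powr \<beta>)) * kernel_sum (\<gamma> n) ^ m)) \<le> f n"
    if n: "n \<ge> 1" for n
  proof -
    have n1: "real n powr \<alpha> \<ge> 1" using n assms by (intro ge_one_powr_ge_zero) auto
    have g: "\<gamma> n > 0" using assms n by (simp add: \<gamma>_def)
    have "kernel_sum (\<gamma> n) \<le> 2 * (1 + real n powr \<alpha> / c)"
      using kernel_sum_le(2)[OF g] by (simp add: \<gamma>_def)
    \<comment> \<open>Since \<open>real n powr \<alpha>\<close> is at least 1, it absorbs the
      additive 1.\<close>
    also have "\<dots> \<le> 2 * (1 + 1 / c) * real n powr \<alpha>"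
      using n1 assms by (simp add: field_simps)
    finally have "kernel_sum (\<gamma> n) ^ m \<le> (2 * (1 + 1 / c) * real n powr \<alpha>) ^ m"
      by (rule power_mono) (rule kernel_sum_le(1)[OF g])
    also have "\<dots> = (2 * (1 + 1 / c)) ^ m * real n powr (\<alpha> * real m)"
      using n by (simp add: power_mult_distrib powr_powr[symmetric] powr_realpow)
    finally have k: "kernel_sum (\<gamma> n) ^ m \<le> (2 * (1 + 1 / c)) ^ m * real n powr (\<alpha> * real m)" .
    have e: "- \<gamma> n * (2 * real m * real n powr \<beta>) = - (2 * real m * c) * real n powr (\<beta> - \<alpha>)"
      using n by (simp add: \<gamma>_def powr_diff)
    have "real n * (C ^ m * exp (- \<gamma> n * (2 * real m * real n powr \<beta>)) * kernel_sum (\<gamma> n) ^ m) \<le>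
      real n * (C ^ m * exp (- \<gamma> n * (2 * real m * real n powr \<beta>)) *
        ((2 * (1 + 1 / c)) ^ m * real n powr (\<alpha> * real m)))"
      using k assms by (intro mult_left_mono) auto
    also have "\<dots> = f n"
      unfolding e f_def M_def using n by (simp add: powr_add)
    finally show ?thesis using kernel_sum_le(1)[OF g] assms by simp
  qed
  show "eventually (\<lambda>n. norm (real n * (C ^ m * exp (- \<gamma> n * (2 * real m * real n powr \<beta>)) *
      kernel_sum (\<gamma> n) ^ m)) \<le> f n) sequentially"
    by (rule eventually_sequentiallyI[OF bound])
qed

text \<open>\<open>Pk k\<close> keeps the 0-based indices below \<open>k\<close>, so subtracting the
  smaller projection retains its cut-off index while the larger one excludes its own. Comparing in
  \<open>int\<close> lets a negative lower end, as for \<open>2 * m * n powr \<beta> > n\<close>,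
  impose no restriction.\<close>

definition in_window :: "real \<Rightarrow> real \<Rightarrow> nat \<Rightarrow> bool" where
  "in_window l1 l2 r \<longleftrightarrow> \<lfloor>l1\<rfloor> - 1 \<le> int r \<and> int r < \<lfloor>l2\<rfloor> + 1"

text \<open>For \<open>l1 \<le> l2\<close> the two projections are nested, so their difference is
  again a coordinate projection and the compression is a \<open>window\<close>.\<close>

lemma trace_norm_compr_eq:
  assumes "l1 \<le> l2"
  shows "trace_norm_compr l1 l2 X = trace_norm_mat (corner (nat (\<lfloor>l2\<rfloor> + 1)) (window (in_window l1 l2) X))"
proof -
  have fl: "\<lfloor>l1\<rfloor> \<le> \<lfloor>l2\<rfloor>" using assms by (rule floor_mono)
  have P: "Pint l1 l2 r s = (if r = s \<and> in_window l1 l2 r then 1 else 0)" for r s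
    using fl by (auto simp: Pint_def Pk_def in_window_def)
  have 1: "mmult X (Pint l1 l2) r s = (if in_window l1 l2 s then X r s else 0)" for r s
    unfolding mmult_def P by (subst infsum_single[of s]) auto
  have "mmult (Pint l1 l2) (mmult X (Pint l1 l2)) = window (in_window l1 l2) X"
  proof (intro ext)
    fix r s
    show "mmult (Pint l1 l2) (mmult X (Pint l1 l2)) r s = window (in_window l1 l2) X r s"
      unfolding mmult_def[of "Pint l1 l2"] P 1 by (subst infsum_single[of r]) (auto simp: window_def)
  qed
  then show ?thesis by (simp add: trace_norm_compr_def Let_def corner_def)
qed

lemma decays_mono: "\<lbrakk>decays A C \<gamma>; C \<le> C'; 0 < \<gamma>'; \<gamma>' \<le> \<gamma>\<rbrakk> \<Longrightarrow> decays A C' \<gamma>'"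
proof -
  assume a: "decays A C \<gamma>" "C \<le> C'" "0 < \<gamma>'" "\<gamma>' \<le> \<gamma>"
  have "cmod (A r s) \<le> C' * exp (- \<gamma>' * \<bar>real r - real s\<bar>)" for r s
  proof -
    have "cmod (A r s) \<le> C * exp (- \<gamma> * \<bar>real r - real s\<bar>)" using a by (simp add: decays_def)
    also have "\<dots> \<le> C' * exp (- \<gamma>' * \<bar>real r - real s\<bar>)"
      using a by (intro mult_mono) (auto simp: decays_def mult_right_mono)
    finally show ?thesis .
  qed
  then show "decays A C' \<gamma>'" using a by (auto simp: decays_def)
qed

lemma masks_members: "\<forall>f\<in>set (masks n ls). f = (\<lambda>_. 1) \<or> f = below n"
  by (auto simp: masks_def)

text \<open>The coefficients \<open>1 / j\<close> and the reciprocal factorials are at most 1, so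
  only the number of compositions enters.\<close>

lemma Cm_diff_le:
  assumes A: "decays A CA \<gamma>A" and B: "decays B CB \<gamma>B" and "m \<ge> 1"
    and bd: "\<And>ls j. ls \<in> compositions m j \<Longrightarrow>
       cmod (crossing_sum n B (masks n ls) - crossing_sum n A (masks n ls)) \<le> T"
  shows "cmod (Cm n m B - Cm n m A) \<le> (\<Sum>j=1..m. real (card (compositions m j))) * T"
proof -
  let ?T = "\<lambda>A ls. mtrace (prodP n A ls) - mtrace (mmult (mpow A m) (Pk (int n)))"
  let ?F = "\<lambda>ls. of_nat (\<Prod>l\<leftarrow>ls. fact l) :: complex"
  let ?c = "\<lambda>j. (-1) ^ (j + 1) / of_nat j :: complex"
  have fact: "(\<Prod>l\<leftarrow>ls. fact l :: nat) \<ge> 1" for ls :: "nat list"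
    by (induction ls) (auto simp: Suc_le_eq)
  have eq: "Cm n m B - Cm n m A = (\<Sum>j=1..m. ?c j * (\<Sum>ls\<in>compositions m j. (?T B ls - ?T A ls) / ?F ls))"
    by (simp only: Cm_def sum_subtractf diff_divide_distrib right_diff_distrib)
  have "cmod (Cm n m B - Cm n m A) \<le> (\<Sum>j=1..m. real (card (compositions m j)) * T)"
    unfolding eq
  proof (rule sum_norm_le)
    fix j assume j: "j \<in> {1..m}"
    have "cmod (\<Sum>ls\<in>compositions m j. (?T B ls - ?T A ls) / ?F ls) \<le> (\<Sum>ls\<in>compositions m j. T)"
    proof (rule sum_norm_le)
      fix ls assume ls: "ls \<in> compositions m j"
      have "cmod ((?T B ls - ?T A ls) / ?F ls) = cmod (?T B ls - ?T A ls) / real (\<Prod>l\<leftarrow>ls. fact l)"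
        by (simp only: norm_divide norm_of_nat)
      also have "\<dots> \<le> cmod (?T B ls - ?T A ls) / 1"
        using fact[of ls] by (intro divide_left_mono) (auto simp: Suc_le_eq)
      also have "\<dots> \<le> T"
        using bd[OF ls] trace_difference_eq_crossing_sum(1)[OF A ls \<open>m \<ge> 1\<close>, of n]
          trace_difference_eq_crossing_sum(1)[OF B ls \<open>m \<ge> 1\<close>, of n] by simp
      finally show "cmod ((?T B ls - ?T A ls) / ?F ls) \<le> T" .
    qed
    then have s: "cmod (\<Sum>ls\<in>compositions m j. (?T B ls - ?T A ls) / ?F ls) \<le> real (card (compositions m j)) * T"
      by simp
    have "cmod (?c j) \<le> 1" using j by (simp add: norm_divide norm_power)
    then have "cmod (?c j * (\<Sum>ls\<in>compositions m j. (?T B ls - ?T A ls) / ?F ls)) \<le>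
       1 * (real (card (compositions m j)) * T)"
      unfolding norm_mult using s by (intro mult_mono) auto
    then show "cmod (?c j * (\<Sum>ls\<in>compositions m j. (?T B ls - ?T A ls) / ?F ls)) \<le> 
       real (card (compositions m j)) * T" by simp
  qed
  then show ?thesis by (simp only: sum_distrib_right)
qed

lemma hypHE:
  assumes "hypH \<alpha> A"
  obtains K C c where "\<And>n. n \<ge> 1 \<Longrightarrow> op_norm_le (A n) K"
    "\<And>n. n \<ge> 1 \<Longrightarrow> decays (A n) C (c / real n powr \<alpha>)" "C > 0" "c > 0"
proof -
  from assms obtain K C c where "\<forall>n\<ge>1. op_norm_le (A n) K" and c: "C > 0" "c > 0"
    and "\<forall>n\<ge>1. \<forall>r s. cmod (A n r s) \<le> C * exp (- c * \<bar>real r - real s\<bar> / real n powr \<alpha>)"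
    unfolding hypH_def by blast
  then show ?thesis by (intro that[of K C c]) (auto simp: decays_def)
qed

theorem theorem3p1:
  fixes \<alpha> \<beta> :: real and m :: nat and A B :: "nat \<Rightarrow> imat"
  assumes "0 < \<alpha>" and "\<alpha> < 1"
    and "hypH \<alpha> A" and "hypH \<alpha> B"
    and "\<beta> > \<alpha>" and "m \<ge> 2"
  shows "\<exists>C::real. \<exists>e::nat \<Rightarrow> real. e \<longlonglongrightarrow> 0 \<and>
    (\<forall>n\<ge>1. cmod (Cm n m (B n) - Cm n m (A n))
       \<le> C * trace_norm_compr (real n - 2 * real m * real n powr \<beta>)
                                (real n + 2 * real m * real n powr \<beta>)
                                (\<lambda>r s. B n r s - A n r s) + e n)"
proof -
  obtain KA CA cA where hA: "\<And>n. n \<ge> 1 \<Longrightarrow> op_norm_le (A n) KA"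
    "\<And>n. n \<ge> 1 \<Longrightarrow> decays (A n) CA (cA / real n powr \<alpha>)" "CA > 0" "cA > 0"
    using hypHE[OF assms(3)] by blast
  obtain KB CB cB where hB: "\<And>n. n \<ge> 1 \<Longrightarrow> op_norm_le (B n) KB"
    "\<And>n. n \<ge> 1 \<Longrightarrow> decays (B n) CB (cB / real n powr \<alpha>)" "CB > 0" "cB > 0"
    using hypHE[OF assms(4)] by blast
  define K where "K = max 1 (max \<bar>KA\<bar> \<bar>KB\<bar>)"
  define C where "C = max CA CB"
  \<comment> \<open>The minimum serves both sequences, and the half makes
    \<open>2 * \<gamma> n\<close> a decay rate for both, as \<open>crossing_sum_window\<close>
    demands.\<close>
  define c where "c = min cA cB / 2"
  define \<gamma> where "\<gamma> = (\<lambda>n::nat. c / real n powr \<alpha>)"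
  define L where "L = (\<lambda>n::nat. 2 * real m * real n powr \<beta>)"
  define M where "M = (\<Sum>j=1..m. real (card (compositions m j)))"
  define \<epsilon> where "\<epsilon> = (\<lambda>n. real n * (C ^ m * exp (- \<gamma> n * L n) * kernel_sum (\<gamma> n) ^ m))"
  have c: "c > 0" "C \<ge> 0" using hA hB by (auto simp: c_def C_def)
  have K: "K \<ge> 1" "\<bar>KA\<bar> \<le> K" "\<bar>KB\<bar> \<le> K" by (auto simp: K_def)
  have "\<epsilon> \<longlonglongrightarrow> 0"
    unfolding \<epsilon>_def \<gamma>_def L_def using assms c by (intro localization_error_tendsto_0) auto
  then have lim: "(\<lambda>n. M * (2 * \<epsilon> n)) \<longlonglongrightarrow> 0"
    by (intro tendsto_mult_right_zero)
  \<comment> \<open>\<open>M\<close> counts the compositions. Each contributes one comparison of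
    compressions and two localization errors, one for each sequence.\<close>
  have "cmod (Cm n m (B n) - Cm n m (A n)) \<le>
     M * (2 * (real m * K ^ m)) * trace_norm_compr (real n - L n) (real n + L n) (\<lambda>r s. B n r s - A n r s)
      + M * (2 * \<epsilon> n)" if n: "n \<ge> 1" for n
  proof -
    define w where "w = in_window (real n - L n) (real n + L n)"
    define N where "N = nat (\<lfloor>real n + L n\<rfloor> + 1)"
    let ?t = "trace_norm_mat (corner N (window w (\<lambda>r s. B n r s - A n r s)))"
    have L0: "L n \<ge> 0" by (simp add: L_def)
    have t: "trace_norm_compr (real n - L n) (real n + L n) (\<lambda>r s. B n r s - A n r s) = ?t"
      unfolding w_def N_def using L0 by (intro trace_norm_compr_eq) simp
    have wN: "x < N" if "w x" for x using that by (auto simp: w_def in_window_def N_def)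
    have "int n \<le> \<lfloor>real n + L n\<rfloor>" using L0 by (simp add: le_floor_iff)
    then have nN: "n \<le> N" unfolding N_def by linarith
    \<comment> \<open>Rounding only enlarges the window, because the floor of \<open>l1\<close>
      minus 1 is below \<open>l1\<close> and the floor of \<open>l2\<close> plus 1 exceeds
      \<open>l2\<close>; points outside are thus still at distance at least \<open>L n\<close> from
      \<open>n\<close>.\<close>
    have wL: "real x \<le> real n - L n \<or> real x \<ge> real n + L n" if "\<not> w x" for x
      using that unfolding w_def in_window_def by linarith
    have g: "c / real n powr \<alpha> > 0" "2 * (c / real n powr \<alpha>) \<le> cA / real n powr \<alpha>"
       "2 * (c / real n powr \<alpha>) \<le> cB / real n powr \<alpha>"
      using n c by (auto simp: c_def intro!: divide_right_mono)
    have dA: "decays (A n) C (2 * \<gamma> n)" and dB: "decays (B n) C (2 * \<gamma> n)"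
      using decays_mono[OF hA(2)[OF n]] decays_mono[OF hB(2)[OF n]] g
      by (auto simp: \<gamma>_def C_def)
    have bd: "cmod (crossing_sum n (B n) (masks n ls) - crossing_sum n (A n) (masks n ls)) \<le>
       2 * (real m * K ^ m) * ?t + 2 * \<epsilon> n" if ls: "ls \<in> compositions m j" for ls j
    proof -
      let ?fs = "masks n ls"
      have len: "length ?fs = m"
        using trace_difference_eq_crossing_sum(2)[OF dA ls] assms by simp
      then have ne: "?fs \<noteq> []" using assms by auto
      have loc: "cmod (crossing_sum n X ?fs - crossing_sum n (window w X) ?fs) \<le> \<epsilon> n"
        if "decays X C (2 * \<gamma> n)" for X
        using crossing_sum_window[OF that ne masks_members wL] by (simp add: len \<epsilon>_def)
      have "cmod (crossing_sum n (window w (B n)) ?fs - crossing_sum n (window w (A n)) ?fs)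
          \<le> 2 * (real m * K ^ m) * ?t"
        using crossing_sum_diff_le[where w = w, OF dA dB hA(1)[OF n] K(2) hB(1)[OF n] K(3) K(1) wN nN masked_masks[of n ls]]
        by (simp add: len)
      with loc[OF dA] loc[OF dB] show ?thesis by (smt (verit) norm_diff_triangle_le norm_minus_commute)
    qed
    have "cmod (Cm n m (B n) - Cm n m (A n)) \<le> M * (2 * (real m * K ^ m) * ?t + 2 * \<epsilon> n)"
      unfolding M_def by (rule Cm_diff_le[OF dA dB _ bd]) (use assms in auto)
    then show ?thesis unfolding t by (simp only: distrib_left mult.assoc)
  qed
  with lim show ?thesis unfolding L_def by blast
qed

end
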